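(* Let $d>1$ be a squarefree integer and let $m,n$ be integers with $m^2-dn^2=-4$. Let $p$ be a prime with $p=x^2+3dy^2$, where $x,y$ are integers with $3\nmid y$ and $x\equiv y\pmod 3$. Then modulo $p$, $$\Big(\frac{m+n\sqrt d}{2}\Big)^{\frac{p-1}{3}}\equiv \begin{cases} 1 & \text{if } m\equiv 0,\pm4\pmod 9,\\ \frac12\Big(-1+\big(\frac{mn/3}{3}\big)\frac{x}{dy}\sqrt d\Big) & \text{if } m\equiv\pm3\pmod 9,\\ \frac12\Big(-1-\big(\frac{mn}{3}\big)\frac{x}{dy}\sqrt d\Big) & \text{if } m\equiv\pm1\pmod 9,\\ \frac12\Big(-1+\big(\frac{mn}{3}\big)\frac{x}{dy}\sqrt d\Big) & \text{if } m\equiv\pm2\pmod 9,\end{cases}$$ where $\big(\frac{\cdot}{3}\big)$ is the Legendre symbol.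
   Context: For such a prime $p$, $d$ is a nonzero square modulo $p$. In the congruence, $\sqrt d$ is interpreted as an integer $s$ with $s^2\equiv d\pmod p$, the same choice of $s$ being used on both sides (the congruence holds for either choice), and the denominators $2$ and $dy$, which are prime to $p$, are inverted modulo $p$. *)

theory Defs
  imports "HOL-Number_Theory.Number_Theory" "HOL-Computational_Algebra.Squarefree"
begin

end

theory Submission
  imports Defs "HOL-Computational_Algebra.Polynomial"
begin

text \<open>
  Let $\varepsilon = (m + ns)/2$. Since $\varepsilon$ has norm $-1$ and $s \equiv x/(y\sqrt{-3})$
  modulo $p$, the power $\varepsilon^{(p-1)/3}$ is the cubic residue symbol $(A/p)_3$ of
  $A = nx - my\sqrt{-3}$ in $\mathbb{Z}[\omega]$. By cubic reciprocity, for a primary primitive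
  $A_1$ the symbol $(A_1/c)_3$ with rational $c$ is a character of $c$ modulo the norm of $A_1$.
  From $pm^2 + 4x^2 = d N(A)$ one gets $p \equiv -(2x/m)^2$, so its value at $p$ is that at
  $m/(2x)$, up to common factors of $m$ and $2x$. Modulo every prime factor of $m$ or $x$ the
  element $A$ is a rational multiple of $1$ or of $\sqrt{-3}$, so that only the factor 3 and the
  unit that makes $A$ primary contribute.

  Reciprocity itself is needed only for a rational modulus and follows from Jacobi sums: if $P$ is
  the Gauss sum of a cubic character $\chi$ modulo $q$, as an element of the group ring
  $\mathbb{Z}[\omega][X]/(X^q-1)$, then $P^{3k+1} = (qJ)^k P$, while
  $P^c \equiv \sum_t \chi(t)^c X^{ct}$ modulo a prime $c$.
\<close>

subsection \<open>Congruences in commutative rings\<close>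

text \<open>In the group ring no root of unity is adjoined, so the coefficient of each X^u can be
  read off, and every Gauss sum identity becomes a statement in Z[omega]. The price is that 1 + X +
  ... + X^(q-1) is not zero: P^3 is not qJ but J times q - (1 + X + ... + X^(q-1)). That factor acts
  as q only on multiples of P, which is why the powers keep a spare factor P. The element A is
  chosen so that modulo p its quotient by its conjugate is (ns - m)/(ns + m), the power -2 of
  epsilon. As -2 = 1 modulo 3, the symbol yields the wanted power of epsilon itself. Rational
  integers have symbol 1, so contents can be removed freely. Two primes need separate care. At 3
  reciprocity says nothing, and the character value has to be drawn from the norm form. At 2 the
  coordinates relative to 1 and sqrt(-3) do not decide whether an element is rational modulo 2, and
  a parity argument resting on squarefreeness of d takes over.\<close>

definition dvdcong :: "'a::comm_ring_1 \<Rightarrow> 'a \<Rightarrow> 'a \<Rightarrow> bool"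
  where "dvdcong m a b \<longleftrightarrow> m dvd a - b"

lemma dvdcong_refl [simp]: "dvdcong m a a"
  by (simp add: dvdcong_def)

lemma dvdcong_sym: "dvdcong m a b \<Longrightarrow> dvdcong m b a"
  unfolding dvdcong_def by (metis dvd_minus_iff minus_diff_eq)

lemma dvdcong_trans [trans]: "dvdcong m a b \<Longrightarrow> dvdcong m b c \<Longrightarrow> dvdcong m a c"
  unfolding dvdcong_def by (metis diff_add_cancel add_diff_eq dvd_add)

lemma dvdcong_eq_trans [trans]: "dvdcong m a b \<Longrightarrow> b = c \<Longrightarrow> dvdcong m a c"
  and eq_dvdcong_trans [trans]: "a = b \<Longrightarrow> dvdcong m b c \<Longrightarrow> dvdcong m a c"
  by simp_all

lemma dvdcong_add: "dvdcong m a b \<Longrightarrow> dvdcong m c d \<Longrightarrow> dvdcong m (a + c) (b + d)"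
  unfolding dvdcong_def by (metis add_diff_add dvd_add)

lemma dvdcong_minus: "dvdcong m a b \<Longrightarrow> dvdcong m (- a) (- b)"
  unfolding dvdcong_def by (metis dvd_minus_iff minus_diff_eq minus_diff_minus)

lemma dvdcong_mult: "dvdcong m a b \<Longrightarrow> dvdcong m c d \<Longrightarrow> dvdcong m (a * c) (b * d)"
proof -
  assume "dvdcong m a b" "dvdcong m c d"
  moreover have "a * c - b * d = (a - b) * c + b * (c - d)"
    by (simp add: algebra_simps)
  ultimately show ?thesis
    unfolding dvdcong_def by (metis dvd_add dvd_mult dvd_mult2)
qed

lemma dvdcong_power: "dvdcong m a b \<Longrightarrow> dvdcong m (a ^ k) (b ^ k)"
  by (induction k) (auto intro: dvdcong_mult)

lemma dvdcong_sum: "(\<And>i. i \<in> I \<Longrightarrow> dvdcong m (f i) (g i)) \<Longrightarrow> dvdcong m (sum f I) (sum g I)"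
  by (induction I rule: infinite_finite_induct) (auto intro: dvdcong_add)

text \<open>The explicit inverse \<open>e\<close> of \<open>a\<close> stands in for coprimality: a
  rational prime may split in Z[omega], and then a nonzero residue need not be invertible.\<close>

lemma dvdcong_cancel_left:
  assumes "dvdcong m (a * b) (a * c)" "dvdcong m (e * a) 1"
  shows "dvdcong m b c"
proof -
  have "dvdcong m (1 * b) (e * a * b)"
    by (intro dvdcong_mult dvdcong_sym[OF assms(2)] dvdcong_refl)
  also have "dvdcong m (e * a * b) (e * a * c)"
    using dvdcong_mult[OF dvdcong_refl[of m e] assms(1)] by (simp add: mult.assoc)
  also have "dvdcong m (e * a * c) (1 * c)"
    by (intro dvdcong_mult assms(2) dvdcong_refl)
  finally show ?thesis by simp
qed

text \<open>All inner binomial coefficients are multiples of the prime \<open>c\<close>. The ring is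
  general because the identity is applied to polynomials over \<open>eis\<close>.\<close>

lemma dvdcong_add_prime_power:
  fixes a b :: "'a::comm_ring_1"
  assumes "prime c"
  shows "dvdcong (of_nat c) ((a + b) ^ c) (a ^ c + b ^ c)"
proof -
  have c: "c > 0" using assms prime_gt_0_nat by blast
  let ?f = "\<lambda>k. of_nat (c choose k) * a ^ k * b ^ (c - k)"
  have set: "{..c} = insert 0 (insert c {1..<c})"
    using c by auto
  have "(a + b) ^ c = (\<Sum>k\<le>c. ?f k)"
    by (rule binomial_ring)
  also have "\<dots> = b ^ c + (a ^ c + (\<Sum>k\<in>{1..<c}. ?f k))"
    unfolding set using c by simp
  finally have *: "(a + b) ^ c - (a ^ c + b ^ c) = (\<Sum>k\<in>{1..<c}. ?f k)"
    by simp
  have "of_nat c dvd ?f k" if "k \<in> {1..<c}" for k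
  proof -
    have "c dvd (c choose k)"
      using assms that by (intro dvd_choose_prime) auto
    then have "(of_nat c :: 'a) dvd of_nat (c choose k)"
      by (metis dvd_def of_nat_mult)
    then show ?thesis by (metis dvd_mult2)
  qed
  then show ?thesis
    unfolding dvdcong_def * by (intro dvd_sum) auto
qed

lemma dvdcong_sum_prime_power:
  fixes f :: "'b \<Rightarrow> 'a::comm_ring_1"
  assumes "prime c"
  shows "dvdcong (of_nat c) ((\<Sum>i\<in>I. f i) ^ c) (\<Sum>i\<in>I. f i ^ c)"
proof (induction I rule: infinite_finite_induct)
  case (insert i I)
  have "dvdcong (of_nat c) ((f i + sum f I) ^ c) (f i ^ c + sum f I ^ c)"
    by (rule dvdcong_add_prime_power[OF assms])
  also have "dvdcong (of_nat c) \<dots> (f i ^ c + (\<Sum>i\<in>I. f i ^ c))"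
    by (intro dvdcong_add insert dvdcong_refl)
  finally show ?case using insert by simp
qed (use assms prime_gt_0_nat in \<open>auto simp: zero_power\<close>)

subsection \<open>Eisenstein integers\<close>

text \<open>\<open>Eis a b\<close> stands for $a + b\omega$ with $\omega^2 + \omega + 1 = 0$.\<close>

datatype eis = Eis (ere: int) (eim: int)

lemma eis_eq_iff: "x = y \<longleftrightarrow> ere x = ere y \<and> eim x = eim y"
  by (cases x; cases y) auto

instantiation eis :: comm_ring_1
begin

definition "0 = Eis 0 0"
definition "1 = Eis 1 0"
definition "x + y = Eis (ere x + ere y) (eim x + eim y)"
definition "x - y = Eis (ere x - ere y) (eim x - eim y)"
definition "- x = Eis (- ere x) (- eim x)"
definition "x * y = Eis (ere x * ere y - eim x * eim y)
  (ere x * eim y + eim x * ere y - eim x * eim y)"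

lemma eis_sel [simp]:
  "ere 0 = 0" "eim 0 = 0" "ere 1 = 1" "eim 1 = 0"
  "ere (x + y) = ere x + ere y" "eim (x + y) = eim x + eim y"
  "ere (x - y) = ere x - ere y" "eim (x - y) = eim x - eim y"
  "ere (- x) = - ere x" "eim (- x) = - eim x"
  "ere (x * y) = ere x * ere y - eim x * eim y"
  "eim (x * y) = ere x * eim y + eim x * ere y - eim x * eim y"
  by (simp_all add: zero_eis_def one_eis_def plus_eis_def minus_eis_def uminus_eis_def times_eis_def)

instance
  by standard (auto simp: eis_eq_iff algebra_simps)

end

lemma eis_of_nat [simp]: "ere (of_nat n) = int n" "eim (of_nat n) = 0"
  by (induction n) auto

lemma eis_of_int [simp]: "ere (of_int k) = k" "eim (of_int k) = 0"
  by (cases k rule: int_cases2; simp)+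

lemma eis_numeral [simp]: "ere (numeral k) = numeral k" "eim (numeral k) = 0"
  using eis_of_nat[of "numeral k"] by simp_all

lemma of_int_dvd_eis_iff: "of_int c dvd z \<longleftrightarrow> c dvd ere z \<and> c dvd eim z"
proof
  assume "c dvd ere z \<and> c dvd eim z"
  then obtain a b where "ere z = c * a" "eim z = c * b" by (auto elim!: dvdE)
  then have "z = of_int c * Eis a b" by (simp add: eis_eq_iff)
  then show "of_int c dvd z" by simp
qed (auto elim!: dvdE)

lemma of_nat_dvd_eis_iff: "of_nat c dvd z \<longleftrightarrow> int c dvd ere z \<and> int c dvd eim z"
  using of_int_dvd_eis_iff[of "int c" z] by simp

definition omega :: eis where "omega = Eis 0 1"

lemma omega_sel [simp]: "ere omega = 0" "eim omega = 1"
  by (simp_all add: omega_def)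

definition cnj_eis :: "eis \<Rightarrow> eis" where
  "cnj_eis z = Eis (ere z - eim z) (- eim z)"

lemma cnj_eis_sel [simp]: "ere (cnj_eis z) = ere z - eim z" "eim (cnj_eis z) = - eim z"
  by (simp_all add: cnj_eis_def)

lemma cnj_eis_simps [simp]:
  "cnj_eis (a + b) = cnj_eis a + cnj_eis b" "cnj_eis (a - b) = cnj_eis a - cnj_eis b"
  "cnj_eis (a * b) = cnj_eis a * cnj_eis b" "cnj_eis (- a) = - cnj_eis a"
  "cnj_eis 0 = 0" "cnj_eis 1 = 1" "cnj_eis (cnj_eis a) = a"
  "cnj_eis (of_nat n) = of_nat n" "cnj_eis (of_int k) = of_int k"
  by (auto simp: eis_eq_iff algebra_simps)

lemma cnj_eis_power [simp]: "cnj_eis (a ^ k) = cnj_eis a ^ k"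
  by (induction k) auto

lemma cnj_eis_sum: "cnj_eis (sum f I) = (\<Sum>i\<in>I. cnj_eis (f i))"
  by (induction I rule: infinite_finite_induct) auto

definition enorm :: "eis \<Rightarrow> int" where
  "enorm z = (ere z)\<^sup>2 - ere z * eim z + (eim z)\<^sup>2"

lemma enorm_mult: "enorm (a * b) = enorm a * enorm b"
  by (simp add: enorm_def power2_eq_square algebra_simps)

lemma enorm_1 [simp]: "enorm 1 = 1"
  by (simp add: enorm_def)

lemma enorm_cnj [simp]: "enorm (cnj_eis a) = enorm a"
  by (simp add: enorm_def power2_eq_square algebra_simps)

lemma enorm_of_int [simp]: "enorm (of_int k) = k\<^sup>2"
  by (simp add: enorm_def)

lemma mult_cnj_eis: "z * cnj_eis z = of_int (enorm z)"
  by (simp add: eis_eq_iff enorm_def power2_eq_square algebra_simps)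

lemma four_enorm: "4 * enorm z = (2 * ere z - eim z)\<^sup>2 + 3 * (eim z)\<^sup>2"
  by (simp add: enorm_def power2_eq_square algebra_simps)

lemma enorm_nonneg: "enorm z \<ge> 0"
  using four_enorm[of z] zero_le_power2[of "2 * ere z - eim z"] zero_le_power2[of "eim z"]
  by linarith

lemma enorm_eq_0: "enorm z = 0 \<longleftrightarrow> z = 0"
proof
  assume "enorm z = 0"
  then have "(2 * ere z - eim z)\<^sup>2 = 0" "(eim z)\<^sup>2 = 0"
    using four_enorm[of z] zero_le_power2[of "2 * ere z - eim z"] zero_le_power2[of "eim z"]
    by linarith+
  then show "z = 0" by (simp add: eis_eq_iff)
qed (simp add: enorm_def)

instance eis :: idom
proof
  fix a b :: eis assume "a \<noteq> 0" "b \<noteq> 0"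
  then show "a * b \<noteq> 0" by (metis enorm_eq_0 enorm_mult mult_eq_0_iff)
qed

lemma dvdcong_cnj: "dvdcong (of_nat c) a b \<Longrightarrow> dvdcong (of_nat c) (cnj_eis a) (cnj_eis b)"
proof -
  assume "dvdcong (of_nat c) a b"
  then obtain e where "a - b = of_nat c * e" by (auto simp: dvdcong_def)
  then have "cnj_eis (a - b) = of_nat c * cnj_eis e" by simp
  then show ?thesis by (simp add: dvdcong_def)
qed

text \<open>The inverse is the conjugate of \<open>z\<close> times an inverse of its norm.\<close>

lemma dvdcong_unit_eis:
  assumes "coprime (enorm z) (int c)"
  shows "\<exists>e. dvdcong (of_nat c) (e * z) 1"
proof -
  obtain u where "[enorm z * u = 1] (mod int c)"
    using assms cong_solve_coprime_int by blast
  then have "int c dvd enorm z * u - 1" by (simp add: cong_iff_dvd_diff)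
  then have "dvdcong (of_nat c) (of_int (enorm z * u) :: eis) 1"
    by (auto simp: dvdcong_def of_nat_dvd_eis_iff)
  also have "of_int (enorm z * u) = (of_int u * cnj_eis z) * z"
    by (simp add: mult_cnj_eis[symmetric] mult_ac)
  finally show ?thesis by blast
qed

subsection \<open>The cubic residue symbol with rational modulus\<close>

definition cube_unit :: "eis \<Rightarrow> bool" where
  "cube_unit u \<longleftrightarrow> u \<in> {1, omega, omega\<^sup>2}"

lemma omega_sq: "omega\<^sup>2 = Eis (-1) (-1)" and omega_cube [simp]: "omega ^ 3 = 1"
  by (simp_all add: eis_eq_iff power2_eq_square power3_eq_cube)

lemma cube_unit_simps [simp]: "cube_unit 1" "cube_unit omega" "cube_unit (omega ^ 2)"
  by (simp_all add: cube_unit_def)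

lemma omega_pow4 [simp]: "omega ^ 4 = omega"
  using omega_cube by (simp add: eval_nat_numeral)

lemma cube_unit_mult [intro]: "cube_unit u \<Longrightarrow> cube_unit v \<Longrightarrow> cube_unit (u * v)"
  unfolding cube_unit_def omega_sq by (auto simp: eis_eq_iff)

lemma cube_unit_power [intro]: "cube_unit u \<Longrightarrow> cube_unit (u ^ k)"
  by (induction k) auto

lemma cube_unit_cube: "cube_unit u \<Longrightarrow> u ^ 3 = 1"
  unfolding cube_unit_def omega_sq by (auto simp: eis_eq_iff power3_eq_cube)

lemma cube_unit_nz: "cube_unit u \<Longrightarrow> u \<noteq> 0"
  unfolding cube_unit_def omega_sq by (auto simp: eis_eq_iff)

lemma cube_unit_cnj: "cube_unit u \<Longrightarrow> cnj_eis u = u ^ 2"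
  unfolding cube_unit_def omega_sq by (auto simp: eis_eq_iff power2_eq_square)

lemma cube_unit_power_mod3: "cube_unit u \<Longrightarrow> u ^ k = u ^ (k mod 3)"
proof -
  assume "cube_unit u"
  have "u ^ k = u ^ (3 * (k div 3) + k mod 3)" by simp
  also have "\<dots> = (u ^ 3) ^ (k div 3) * u ^ (k mod 3)" by (simp only: power_add power_mult)
  finally show ?thesis using cube_unit_cube[OF \<open>cube_unit u\<close>] by simp
qed

text \<open>Two distinct cube roots of unity differ by an element with a coordinate 1 or -1, which a
  rational prime cannot divide.\<close>

lemma cube_unit_eqI:
  assumes "cube_unit u" "cube_unit v" "dvdcong (of_nat c) u v" "prime c" "c \<noteq> 3"
  shows "u = v"
proof (rule ccontr)
  assume "u \<noteq> v"
  have "\<not> int c dvd 1 \<and> \<not> (int c dvd 2 \<and> int c dvd 1)"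
    using assms prime_gt_1_nat by fastforce
  then show False
    using assms(1-3) \<open>u \<noteq> v\<close> unfolding cube_unit_def omega_sq dvdcong_def of_nat_dvd_eis_iff
    by (auto simp: eis_eq_iff)
qed

text \<open>\<open>cubic_symbol c z u\<close> states $(z/c)_3 = u$ for a prime $c \neq 3$. If $c = 3k + 1$ splits as
  $\pi\bar\pi$, then $(z/c)_3 = (z/\pi)_3 (z/\bar\pi)_3 = (z/\pi)_3 / (\bar z/\pi)_3$, which is
  $(z/\bar z)^k$ modulo $\pi$. If $c = 3k + 2$, then $(z/c)_3 = z^{(c^2-1)/3}$, which is
  $(\bar z/z)^{k+1}$ because of $z^c \equiv \bar z$.\<close>
definition cubic_symbol :: "nat \<Rightarrow> eis \<Rightarrow> eis \<Rightarrow> bool" where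
  "cubic_symbol c z u \<longleftrightarrow> cube_unit u \<and>
     (if c mod 3 = 1 then dvdcong (of_nat c) (u * cnj_eis z ^ (c div 3)) (z ^ (c div 3))
      else dvdcong (of_nat c) (u * z ^ (c div 3 + 1)) (cnj_eis z ^ (c div 3 + 1)))"

lemma cubic_symbol_unit: "cubic_symbol c z u \<Longrightarrow> cube_unit u"
  by (simp add: cubic_symbol_def)

lemma cubic_symbol_mult:
  assumes "cubic_symbol c y u" "cubic_symbol c z v"
  shows "cubic_symbol c (y * z) (u * v)"
proof (cases "c mod 3 = 1")
  case True
  have "dvdcong (of_nat c) ((u * cnj_eis y ^ (c div 3)) * (v * cnj_eis z ^ (c div 3)))
     (y ^ (c div 3) * z ^ (c div 3))"
    using assms True by (intro dvdcong_mult) (auto simp: cubic_symbol_def)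
  then show ?thesis
    using assms True by (auto simp: cubic_symbol_def power_mult_distrib mult_ac)
next
  case False
  let ?k = "c div 3 + 1"
  have "dvdcong (of_nat c) ((u * y ^ ?k) * (v * z ^ ?k)) (cnj_eis y ^ ?k * cnj_eis z ^ ?k)"
    using assms False by (intro dvdcong_mult) (auto simp: cubic_symbol_def)
  moreover have "(u * y ^ ?k) * (v * z ^ ?k) = u * v * (y * z) ^ ?k"
    "cnj_eis y ^ ?k * cnj_eis z ^ ?k = cnj_eis (y * z) ^ ?k"
    by (simp_all only: power_mult_distrib mult_ac cnj_eis_simps)
  ultimately show ?thesis
    using assms False unfolding cubic_symbol_def by (metis cube_unit_mult)
qed

lemma cubic_symbol_power: "cubic_symbol c z u \<Longrightarrow> cubic_symbol c (z ^ k) (u ^ k)"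
proof (induction k)
  case 0
  then show ?case by (simp add: cubic_symbol_def)
qed (simp add: cubic_symbol_mult)

lemma cubic_symbol_cong:
  assumes "dvdcong (of_nat c) y z" "cubic_symbol c y u"
  shows "cubic_symbol c z u"
proof -
  have yz: "dvdcong (of_nat c) z y" using assms(1) by (rule dvdcong_sym)
  note cyz = dvdcong_cnj[OF yz]
  show ?thesis
  proof (cases "c mod 3 = 1")
    case True
    have "dvdcong (of_nat c) (u * cnj_eis z ^ (c div 3)) (u * cnj_eis y ^ (c div 3))"
      by (intro dvdcong_mult dvdcong_power cyz dvdcong_refl)
    also have "dvdcong (of_nat c) \<dots> (y ^ (c div 3))"
      using assms(2) True by (simp add: cubic_symbol_def)
    also have "dvdcong (of_nat c) \<dots> (z ^ (c div 3))"
      by (intro dvdcong_power assms)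
    finally show ?thesis using assms(2) True by (simp add: cubic_symbol_def)
  next
    case False
    have "dvdcong (of_nat c) (u * z ^ (c div 3 + 1)) (u * y ^ (c div 3 + 1))"
      by (intro dvdcong_mult dvdcong_power yz dvdcong_refl)
    also have "dvdcong (of_nat c) \<dots> (cnj_eis y ^ (c div 3 + 1))"
      using assms(2) False by (simp add: cubic_symbol_def)
    also have "dvdcong (of_nat c) \<dots> (cnj_eis z ^ (c div 3 + 1))"
      by (intro dvdcong_power dvdcong_cnj assms)
    finally show ?thesis using assms(2) False by (simp add: cubic_symbol_def)
  qed
qed

text \<open>\<open>cubic_symbol\<close> is a relation, which makes multiplicativity immediate. That
  it determines its value requires cancelling a power of \<open>z\<close> or of its conjugate, hence
  the condition on the norm.\<close>

lemma cubic_symbol_unique: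
  assumes "cubic_symbol c z u" "cubic_symbol c z v" "prime c" "c \<noteq> 3" "\<not> int c dvd enorm z"
  shows "u = v"
proof (rule cube_unit_eqI)
  show "cube_unit u" "cube_unit v" using assms cubic_symbol_unit by auto
  have cop: "coprime (enorm z) (int c)"
    using assms(3,5) by (metis coprime_commute prime_imp_coprime prime_nat_int_transfer)
  have unit: "\<exists>e. dvdcong (of_nat c) (e * y ^ k) 1" if y: "enorm y = enorm z" for y k
  proof -
    obtain e where "dvdcong (of_nat c) (e * y) 1"
      using dvdcong_unit_eis[of y c] cop y by auto
    from dvdcong_power[OF this, of k] show ?thesis by (auto simp: power_mult_distrib)
  qed
  show "dvdcong (of_nat c) u v"
  proof (cases "c mod 3 = 1")
    case True
    obtain e where e: "dvdcong (of_nat c) (e * cnj_eis z ^ (c div 3)) 1" using unit[of "cnj_eis z"] by auto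
    have "dvdcong (of_nat c) (cnj_eis z ^ (c div 3) * u) (cnj_eis z ^ (c div 3) * v)"
      using assms(1,2) True dvdcong_trans dvdcong_sym by (simp add: cubic_symbol_def mult.commute) blast
    then show ?thesis using e dvdcong_cancel_left by blast
  next
    case False
    obtain e where e: "dvdcong (of_nat c) (e * z ^ (c div 3 + 1)) 1"
      using unit[OF refl] by blast
    have "dvdcong (of_nat c) (z ^ (c div 3 + 1) * u) (z ^ (c div 3 + 1) * v)"
      using assms(1,2) False dvdcong_trans dvdcong_sym unfolding cubic_symbol_def mult.commute[of _ u]
        mult.commute[of _ v] by (simp del: power_Suc add_Suc_right) blast
    then show ?thesis using e dvdcong_cancel_left by blast
  qed
qed (use assms in auto)

text \<open>Rational integers are their own conjugates. This is what allows rational factors to be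
  dropped from any symbol.\<close>

lemma cubic_symbol_of_int: "cubic_symbol c (of_int k) 1"
  by (simp add: cubic_symbol_def)

lemma dvdcongE:
  assumes "dvdcong m a b"
  obtains z where "a = b + m * z"
proof -
  obtain z where "a - b = m * z" using assms unfolding dvdcong_def by (elim dvdE)
  then have "a = b + m * z" by (simp add: diff_eq_eq add.commute)
  then show thesis by (rule that)
qed

subsection \<open>The group ring of the residues modulo \<open>q\<close>\<close>

text \<open>\<open>gpoly q f\<close> represents $\sum_t f(t) X^t$ in the group ring $R[X]/(X^q - 1)$; equality there is
  congruence modulo \<open>cyc q\<close>.\<close>
definition gpoly :: "nat \<Rightarrow> (int \<Rightarrow> 'a::comm_ring_1) \<Rightarrow> 'a poly" where
  "gpoly q f = (\<Sum>t<q. monom (f (int t)) t)"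

abbreviation cyc :: "nat \<Rightarrow> 'a::comm_ring_1 poly" where
  "cyc q \<equiv> monom 1 q - 1"

text \<open>Coefficient functions are defined on all integers so that arguments such as
  \<open>u - s\<close> need no reduction; periodicity makes them functions on residues.\<close>

definition periodic :: "nat \<Rightarrow> (int \<Rightarrow> 'a) \<Rightarrow> bool" where
  "periodic q f \<longleftrightarrow> (\<forall>a b. [a = b] (mod int q) \<longrightarrow> f a = f b)"

lemma periodicI: "(\<And>a b. [a = b] (mod int q) \<Longrightarrow> f a = f b) \<Longrightarrow> periodic q f"
  by (simp add: periodic_def)

lemma periodicD: "periodic q f \<Longrightarrow> [a = b] (mod int q) \<Longrightarrow> f a = f b"
  by (simp add: periodic_def)

lemma gpoly_add: "gpoly q (\<lambda>u. f u + g u) = gpoly q f + gpoly q g"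
  by (simp add: gpoly_def sum.distrib flip: add_monom)

lemma gpoly_minus: "gpoly q (\<lambda>u. f u - g u) = gpoly q f - gpoly q g"
  by (simp add: gpoly_def sum_subtractf flip: diff_monom)

lemma gpoly_scale: "gpoly q (\<lambda>u. a * f u) = [:a:] * gpoly q f"
  by (simp add: gpoly_def sum_distrib_left smult_monom)

lemma coeff_gpoly: "u < q \<Longrightarrow> coeff (gpoly q f) u = f (int u)"
  by (simp add: gpoly_def coeff_sum)

lemma degree_gpoly_less: "q > 0 \<Longrightarrow> degree (gpoly q f) < q"
  by (rule degree_lessI) (auto simp: gpoly_def coeff_sum)

lemma monom_cyc: "dvdcong (cyc q) (monom a n) (monom a (n mod q))"
proof -
  have "monom a n = monom a (q * (n div q) + n mod q)" by simp
  also have "\<dots> = monom 1 q ^ (n div q) * monom a (n mod q)"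
    by (simp add: monom_power mult_monom)
  finally have eq: "monom a n = monom 1 q ^ (n div q) * monom a (n mod q)" .
  have "dvdcong (cyc q) (monom 1 q) (1 :: 'a poly)"
    by (simp add: dvdcong_def)
  from dvdcong_power[OF this, of "n div q"]
  have "dvdcong (cyc q) (monom 1 q ^ (n div q) * monom a (n mod q)) (1 ^ (n div q) * monom a (n mod q))"
    by (rule dvdcong_mult) (rule dvdcong_refl)
  then show ?thesis unfolding eq by simp
qed

lemma sum_reindex_mod:
  fixes f :: "int \<Rightarrow> 'a::comm_ring_1" and r :: "int \<Rightarrow> int"
  assumes "q > 0" "\<And>t t'. [r t = r t'] (mod int q) \<Longrightarrow> [t = t'] (mod int q)" "periodic q f"
  shows "(\<Sum>t<q. f (r (int t))) = (\<Sum>t<q. f (int t))"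
proof -
  let ?h = "\<lambda>t. nat (r (int t) mod int q)"
  have inj: "inj_on ?h {..<q}"
  proof (rule inj_onI)
    fix s t assume st: "s \<in> {..<q}" "t \<in> {..<q}" "?h s = ?h t"
    have "r (int s) mod int q \<ge> 0" "r (int t) mod int q \<ge> 0"
      using assms(1) by simp_all
    with st have "[r (int s) = r (int t)] (mod int q)"
      unfolding cong_def by (metis int_nat_eq)
    then have "[int s = int t] (mod int q)" by (rule assms)
    then show "s = t" using st by (simp add: cong_def)
  qed
  have im: "?h ` {..<q} = {..<q}"
    using inj by (intro endo_inj_surj) (auto simp: assms(1) nat_less_iff)
  have "(\<Sum>t<q. f (int t)) = (\<Sum>t\<in>?h ` {..<q}. f (int t))" using im by simp
  also have "\<dots> = (\<Sum>t<q. f (int (?h t)))" by (simp add: sum.reindex[OF inj])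
  also have "\<dots> = (\<Sum>t<q. f (r (int t)))"
    using assms(1) by (intro sum.cong refl periodicD[OF assms(3)]) (simp add: cong_def)
  finally show ?thesis by simp
qed

text \<open>A permutation \<open>r\<close> of the residues moves the coefficient of X^t to X^(r t).
  It is used for translations, in products, and for multiplication by \<open>c\<close>, in the c-th
  power map.\<close>

lemma gpoly_reindex:
  assumes "q > 0" "\<And>t t'. [r t = r t'] (mod int q) \<Longrightarrow> [t = t'] (mod int q)"
    and "\<And>t t'. [t = t'] (mod int q) \<Longrightarrow> [r t = r t'] (mod int q)"
    and "\<And>t. t \<ge> 0 \<Longrightarrow> r t \<ge> 0"
    and "periodic q f" "periodic q h" "\<And>t. h (r t) = f t"
  shows "dvdcong (cyc q) (\<Sum>t<q. monom (f (int t)) (nat (r (int t)))) (gpoly q h)"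
proof -
  have "dvdcong (cyc q) (\<Sum>t<q. monom (f (int t)) (nat (r (int t))))
          (\<Sum>t<q. monom (h (r (int t))) (nat (r (int t)) mod q))"
    by (intro dvdcong_sum) (simp add: assms(7) monom_cyc)
  also have "(\<Sum>t<q. monom (h (r (int t))) (nat (r (int t)) mod q)) =
        (\<Sum>t<q. monom (h (r (int t))) (nat (r (int t) mod int q)))"
    using assms(4) by (intro sum.cong) (auto simp: nat_mod_distrib)
  also have "\<dots> = (\<Sum>t<q. monom (h (int t)) (nat (int t mod int q)))"
  proof (rule sum_reindex_mod[where f = "\<lambda>z. monom (h z) (nat (z mod int q))" and r = r])
    show "periodic q (\<lambda>z. monom (h z) (nat (z mod int q)))"
    proof (rule periodicI)
      fix a b assume ab: "[a = b] (mod int q)"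
      then show "monom (h a) (nat (a mod int q)) = monom (h b) (nat (b mod int q))"
        using periodicD[OF assms(6) ab] by (simp add: cong_def)
    qed
  qed (fact assms(1), erule assms(2))
  also have "\<dots> = gpoly q h"
    unfolding gpoly_def by (intro sum.cong) (auto simp flip: of_nat_mod)
  finally show ?thesis .
qed

lemma gpoly_mult:
  assumes "q > 0" "periodic q f" "periodic q g"
  shows "dvdcong (cyc q) (gpoly q f * gpoly q g) (gpoly q (\<lambda>u. \<Sum>s<q. f (int s) * g (u - int s)))"
proof -
  have "gpoly q f * gpoly q g = (\<Sum>s<q. \<Sum>t<q. monom (f (int s) * g (int t)) (s + t))"
    by (simp add: gpoly_def sum_product mult_monom)
  also have "\<dots> = (\<Sum>s<q. \<Sum>t<q. monom (f (int s) * g (int t)) (nat (int s + int t)))"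
    by (simp add: nat_add_distrib)
  also have "dvdcong (cyc q) \<dots> (\<Sum>s<q. gpoly q (\<lambda>u. f (int s) * g (u - int s)))"
  proof (intro dvdcong_sum)
    fix s
    show "dvdcong (cyc q) (\<Sum>t<q. monom (f (int s) * g (int t)) (nat (int s + int t)))
            (gpoly q (\<lambda>u. f (int s) * g (u - int s)))"
    proof (rule gpoly_reindex[where f = "\<lambda>t. f (int s) * g t"])
      show "periodic q (\<lambda>t. f (int s) * g t)"
        using assms(3) unfolding periodic_def by metis
      have "g (a - int s) = g (b - int s)" if "[a = b] (mod int q)" for a b
        using cong_diff[OF that cong_refl, of "int s"] by (rule periodicD[OF assms(3)])
      then show "periodic q (\<lambda>t. f (int s) * g (t - int s))"
        unfolding periodic_def by metis
      show "\<And>t t'. [int s + t = int s + t'] (mod int q) \<Longrightarrow> [t = t'] (mod int q)"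
        by (simp add: cong_add_lcancel)
    qed (use assms in \<open>auto simp: cong_add_lcancel\<close>)
  qed
  also have "(\<Sum>s<q. gpoly q (\<lambda>u. f (int s) * g (u - int s))) =
      gpoly q (\<lambda>u. \<Sum>s<q. f (int s) * g (u - int s))"
    unfolding gpoly_def by (subst sum.swap) (simp add: monom_sum)
  finally show ?thesis .
qed

text \<open>Needed for the multiple of \<open>c\<close> left over in a c-th power, whose cofactor is
  an arbitrary polynomial.\<close>

lemma dvdcong_gpoly_exists:
  assumes "q > 0"
  shows "\<exists>z. dvdcong (cyc q) Z (gpoly q z)"
proof -
  have "Z = (\<Sum>i\<le>degree Z. monom (coeff Z i) i)"
    by (simp add: poly_as_sum_of_monoms)
  also have "dvdcong (cyc q) \<dots> (\<Sum>i\<le>degree Z. monom (coeff Z i) (i mod q))"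
    by (intro dvdcong_sum monom_cyc)
  also have "(\<Sum>i\<le>degree Z. monom (coeff Z i) (i mod q)) =
      (\<Sum>i\<le>degree Z. gpoly q (\<lambda>u. if u = int (i mod q) then coeff Z i else 0))"
  proof (intro sum.cong refl)
    fix i
    have "gpoly q (\<lambda>u. if u = int (i mod q) then coeff Z i else 0) =
        (\<Sum>t<q. if t = i mod q then monom (coeff Z i) t else 0)"
      unfolding gpoly_def by (intro sum.cong) (auto simp del: of_nat_mod)
    then show "monom (coeff Z i) (i mod q) = gpoly q (\<lambda>u. if u = int (i mod q) then coeff Z i else 0)"
      using assms by simp
  qed
  also have "\<dots> = gpoly q (\<lambda>u. \<Sum>i\<le>degree Z. if u = int (i mod q) then coeff Z i else 0)"
    unfolding gpoly_def by (subst sum.swap) (simp add: monom_sum)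
  finally show ?thesis by blast
qed

text \<open>Both representatives have degree below \<open>q\<close>, the degree of
  \<open>cyc q\<close>, so a nonzero difference cannot be a multiple of it.\<close>

lemma gpoly_inj:
  fixes f g :: "int \<Rightarrow> 'a::idom"
  assumes "dvdcong (cyc q) (gpoly q f) (gpoly q g)" "u < q"
  shows "f (int u) = g (int u)"
proof -
  have q: "q > 0" using assms by simp
  have deg: "degree (cyc q :: 'a poly) = q"
    by (rule antisym[OF degree_le le_degree]) (use q in auto)
  have "cyc q dvd gpoly q (\<lambda>u. f u - g u)"
    using assms by (simp add: dvdcong_def gpoly_minus)
  then obtain Q where Q: "gpoly q (\<lambda>u. f u - g u) = cyc q * Q" by (auto elim: dvdE)
  have "Q = 0"
  proof (rule ccontr)
    assume "Q \<noteq> 0"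
    moreover have "cyc q \<noteq> (0 :: 'a poly)" using deg q by (metis degree_0 less_not_refl)
    ultimately have "degree (cyc q * Q) \<ge> q" by (simp add: degree_mult_eq deg)
    then show False using degree_gpoly_less[OF q, of "\<lambda>u. f u - g u"] Q by simp
  qed
  then have "coeff (gpoly q (\<lambda>u. f u - g u)) u = 0" using Q by simp
  then show ?thesis using assms(2) by (simp add: coeff_gpoly)
qed

text \<open>Modulo \<open>c\<close>, the c-th power of the sum of the f(t) X^t is the sum of the
  f(t)^c X^(ct); the coefficients of X^u with u = ct are compared.\<close>

lemma gpoly_frobenius:
  fixes f h :: "int \<Rightarrow> 'a::idom"
  assumes "prime c" "coprime c q" "q > 0" "periodic q f"
    and pow: "dvdcong (cyc q) (gpoly q f ^ c) (gpoly q h)"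
    and "u < q" "[int c * t = int u] (mod int q)"
  shows "dvdcong (of_nat c) (h (int u)) (f t ^ c)"
proof -
  have cop: "coprime (int c) (int q)" using assms(2) by simp
  obtain c' where c': "[int c * c' = 1] (mod int q)"
    using cong_solve_coprime_int[OF cop] by blast
  have inv: "[c' * (int c * t) = t] (mod int q)" for t
    using cong_mult[OF c' cong_refl, of t] by (simp add: mult_ac)
  \<comment> \<open>Coefficient of X^u in the power: \<open>c'\<close> undoes the multiplication of
    exponents by \<open>c\<close>.\<close>
  define F where "F = (\<lambda>u. f (c' * u) ^ c)"
  have F: "F (int c * t) = f t ^ c" for t
    unfolding F_def using periodicD[OF assms(4) inv[of t]] by simp
  have perF: "periodic q F"
  proof (rule periodicI)
    fix a b assume "[a = b] (mod int q)"
    then have "[c' * a = c' * b] (mod int q)" by (intro cong_mult cong_refl)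
    from periodicD[OF assms(4) this] show "F a = F b" unfolding F_def by simp
  qed
  have "dvdcong (of_nat c) (gpoly q f ^ c) (\<Sum>t<q. monom (f (int t)) t ^ c)"
    unfolding gpoly_def by (rule dvdcong_sum_prime_power[OF assms(1)])
  also have "(\<Sum>t<q. monom (f (int t)) t ^ c) = (\<Sum>t<q. monom (f (int t) ^ c) (nat (int c * int t)))"
    by (simp add: monom_power mult.commute nat_mult_distrib)
  finally obtain Z where Z: "gpoly q f ^ c =
      (\<Sum>t<q. monom (f (int t) ^ c) (nat (int c * int t))) + of_nat c * Z"
    by (rule dvdcongE)
  obtain z where z: "dvdcong (cyc q) Z (gpoly q z)"
    using dvdcong_gpoly_exists assms(3) by blast
  have "dvdcong (cyc q) (gpoly q h) (gpoly q f ^ c)"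
    using pow by (rule dvdcong_sym)
  also have "dvdcong (cyc q) (gpoly q f ^ c) (gpoly q F + of_nat c * gpoly q z)"
    unfolding Z
  proof (intro dvdcong_add dvdcong_mult dvdcong_refl z gpoly_reindex[where f = "\<lambda>t. f t ^ c"] perF)
    show "periodic q (\<lambda>t. f t ^ c)"
      using assms(4) unfolding periodic_def by metis
    show "\<And>t t'. [int c * t = int c * t'] (mod int q) \<Longrightarrow> [t = t'] (mod int q)"
      using cop by (simp add: cong_mult_lcancel)
    show "\<And>t t'. [t = t'] (mod int q) \<Longrightarrow> [int c * t = int c * t'] (mod int q)"
      by (intro cong_mult cong_refl)
  qed (use assms F in auto)
  also have "gpoly q F + of_nat c * gpoly q z = gpoly q (\<lambda>u. F u + of_nat c * z u)"
    by (simp add: gpoly_add gpoly_scale of_nat_poly)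
  finally have "h (int u) = F (int u) + of_nat c * z (int u)"
    using assms(6) by (rule gpoly_inj)
  moreover have "F (int u) = f t ^ c"
    using periodicD[OF perF assms(7)] F by simp
  ultimately show ?thesis by (simp add: dvdcong_def)
qed

lemma prime_3_nat: "prime (3::nat)"
  by simp

subsection \<open>Cubic characters and their Jacobi sums\<close>

locale cubic_character =
  fixes q :: nat and chi :: "int \<Rightarrow> eis"
  assumes prime_q: "prime q"
    and chi_mult: "chi (a * b) = chi a * chi b"
    and chi_cong: "[a = b] (mod int q) \<Longrightarrow> chi a = chi b"
    and chi_unit: "\<not> int q dvd a \<Longrightarrow> cube_unit (chi a)"
    and chi_0: "int q dvd a \<Longrightarrow> chi a = 0"
    and chi_nontrivial: "\<exists>a. chi a \<noteq> 0 \<and> chi a \<noteq> 1"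
begin

abbreviation P where "P \<equiv> gpoly q chi"
abbreviation Q where "Q \<equiv> gpoly q (\<lambda>t. cnj_eis (chi t))"
text \<open>Coefficients of q - (1 + X + ... + X^(q-1)). A q-th root of unity other than 1 in place
  of X would turn this element into q.\<close>

abbreviation D :: "int \<Rightarrow> eis" where "D \<equiv> \<lambda>u. (if int q dvd u then of_nat q else 0) - 1"

definition J :: eis where "J = (\<Sum>s<q. chi (int s) * chi (1 - int s))"

lemma q_pos: "q > 0" and q_gt1: "q > 1"
  using prime_q prime_gt_0_nat prime_gt_1_nat by blast+

lemma chi_1: "chi 1 = 1"
proof -
  have "\<not> int q dvd 1" using q_gt1 by auto
  then have "chi 1 \<noteq> 0" using chi_unit cube_unit_nz by blast
  moreover have "chi 1 * chi 1 = chi 1" using chi_mult[of 1 1] by simp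
  ultimately show ?thesis by simp
qed

text \<open>The value is both a square root and a cube root of 1.\<close>

lemma chi_minus1: "chi (-1) = 1"
proof -
  have "chi (-1) ^ 2 = 1" using chi_mult[of "-1" "-1"] chi_1 by (simp add: power2_eq_square)
  moreover have "\<not> int q dvd -1" using q_gt1 by auto
  then have "chi (-1) ^ 3 = 1" using chi_unit cube_unit_cube by blast
  ultimately show ?thesis by (simp add: power3_eq_cube power2_eq_square)
qed

lemma chi_minus: "chi (- a) = chi a"
  using chi_mult[of "-1" a] chi_minus1 by simp

lemma chi_sq: "chi a ^ 2 = cnj_eis (chi a)"
  using cube_unit_cnj[OF chi_unit, of a] chi_0[of a] by (cases "int q dvd a") auto

lemma chi_mult_cnj: "chi a * cnj_eis (chi a) = (if int q dvd a then 0 else 1)"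
proof (cases "int q dvd a")
  case False
  then show ?thesis
    using cube_unit_cube[OF chi_unit[OF False]] by (simp add: chi_sq[symmetric] power2_eq_square power3_eq_cube mult_ac)
qed (simp add: chi_0)

lemma cubic_character_cnj: "cubic_character q (\<lambda>a. cnj_eis (chi a))"
proof
  show "\<And>a. \<not> int q dvd a \<Longrightarrow> cube_unit (cnj_eis (chi a))"
    using chi_unit by (metis chi_sq cube_unit_power)
  show "\<exists>a. cnj_eis (chi a) \<noteq> 0 \<and> cnj_eis (chi a) \<noteq> 1"
    using chi_nontrivial by (metis cnj_eis_simps(5,6,7))
qed (auto simp: prime_q chi_mult chi_0 intro: arg_cong[OF chi_cong])

lemma periodic_chi: "periodic q chi" "periodic q (\<lambda>t. cnj_eis (chi t))"
  by (auto intro!: periodicI chi_cong arg_cong[of _ _ cnj_eis])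

lemma periodic_D: "periodic q D"
  by (auto simp: cong_dvd_iff intro!: periodicI)

lemma sum_mult_reindex:
  fixes f :: "int \<Rightarrow> eis"
  assumes "\<not> int q dvd a" "periodic q f"
  shows "(\<Sum>t<q. f (a * int t)) = (\<Sum>t<q. f (int t))"
proof (rule sum_reindex_mod[where r = "\<lambda>t. a * t"])
  have "coprime a (int q)"
    using assms(1) prime_q by (metis coprime_commute prime_imp_coprime prime_nat_int_transfer)
  then show "\<And>t t'. [a * t = a * t'] (mod int q) \<Longrightarrow> [t = t'] (mod int q)"
    by (simp add: cong_mult_lcancel)
qed (use assms q_pos in auto)

lemma sum_chi: "(\<Sum>t<q. chi (int t)) = 0"
proof -
  obtain a where a: "chi a \<noteq> 0" "chi a \<noteq> 1" using chi_nontrivial by blast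
  have "(\<Sum>t<q. chi (int t)) = (\<Sum>t<q. chi (a * int t))"
    by (rule sum_mult_reindex[symmetric]) (use a chi_0 periodic_chi in auto)
  also have "\<dots> = chi a * (\<Sum>t<q. chi (int t))"
    by (simp add: chi_mult sum_distrib_left)
  finally have "(chi a - 1) * (\<Sum>t<q. chi (int t)) = 0" by (simp add: algebra_simps)
  then show ?thesis using a by simp
qed

lemma sum_cnj_chi: "(\<Sum>t<q. cnj_eis (chi (int t))) = 0"
  using sum_chi by (simp flip: cnj_eis_sum)

lemma chi_mod: "chi (t mod int q) = chi t"
  by (rule chi_cong) (simp add: cong_def)

lemma sum_chi_shift: "(\<Sum>s<q. chi (u - int s)) = 0"
proof -
  have "(\<Sum>s<q. chi (u - int s)) = (\<Sum>s<q. chi (int s))"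
  proof (rule sum_reindex_mod[where r = "\<lambda>t. u - t"])
    show "\<And>t t'. [u - t = u - t'] (mod int q) \<Longrightarrow> [t = t'] (mod int q)"
      by (metis cong_diff cong_refl diff_diff_eq2 add_diff_cancel_left')
  qed (use periodic_chi q_pos in auto)
  then show ?thesis using sum_chi by simp
qed

text \<open>Substituting s = uv pulls \<open>chi u\<close> out of the sum. A general
  \<open>f\<close> covers both \<open>chi\<close> and its conjugate.\<close>

lemma sum_twisted:
  assumes "\<not> int q dvd u" "periodic q f"
  shows "(\<Sum>s<q. chi (int s) * f (u - int s)) = chi u * (\<Sum>v<q. chi (int v) * f (u * (1 - int v)))"
proof -
  have "(\<Sum>s<q. chi (int s) * f (u - int s)) = (\<Sum>s<q. chi (u * int s) * f (u - u * int s))"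
  proof (rule sum_mult_reindex[symmetric])
    show "periodic q (\<lambda>s. chi s * f (u - s))"
    proof (rule periodicI)
      fix a b assume ab: "[a = b] (mod int q)"
      then have "[u - a = u - b] (mod int q)" by (intro cong_diff cong_refl)
      then show "chi a * f (u - a) = chi b * f (u - b)"
        using chi_cong[OF ab] periodicD[OF assms(2)] by metis
    qed
  qed (use assms in auto)
  then show ?thesis
    by (simp add: chi_mult sum_distrib_left algebra_simps)
qed

lemma conv_chi_chi: "(\<Sum>s<q. chi (int s) * chi (u - int s)) = J * cnj_eis (chi u)"
proof (cases "int q dvd u")
  case True
  have "(\<Sum>s<q. chi (int s) * chi (u - int s)) = (\<Sum>s<q. cnj_eis (chi (int s)))"
  proof (intro sum.cong refl)
    fix s
    have "[u - int s = - int s] (mod int q)" using True by (simp add: cong_iff_dvd_diff)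
    then have "chi (u - int s) = chi (int s)" using chi_cong chi_minus by metis
    then show "chi (int s) * chi (u - int s) = cnj_eis (chi (int s))"
      by (simp add: chi_sq[symmetric] power2_eq_square)
  qed
  then show ?thesis using sum_cnj_chi True chi_0 by simp
next
  case False
  have "(\<Sum>s<q. chi (int s) * chi (u - int s)) =
      chi u * (\<Sum>s<q. chi (int s) * chi (u * (1 - int s)))"
    by (rule sum_twisted[OF False periodic_chi(1)])
  also have "\<dots> = chi u ^ 2 * J"
    by (simp add: J_def chi_mult sum_distrib_left power2_eq_square mult_ac)
  finally show ?thesis by (simp add: chi_sq mult.commute)
qed

lemma sum_D_type:
  "(\<Sum>s<q. (if int q dvd int s then a else b :: eis)) = a + of_nat (q - 1) * b"
proof -
  have "(\<Sum>s<q. (if int q dvd int s then a else b)) = (\<Sum>s\<in>insert 0 {1..<q}. (if int q dvd int s then a else b))"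
    using q_pos by (intro sum.cong) auto
  also have "\<dots> = a + (\<Sum>s\<in>{1..<q}. (if int q dvd int s then a else b))"
    by simp
  also have "(\<Sum>s\<in>{1..<q}. (if int q dvd int s then a else b)) = (\<Sum>s\<in>{1..<q}. b)"
    by (intro sum.cong) (auto dest: dvd_imp_le)
  finally show ?thesis by simp
qed

lemma conv_chi_cnj: "(\<Sum>s<q. chi (int s) * cnj_eis (chi (u - int s))) = D u"
proof -
  define K where "K = (\<Sum>s<q. chi (int s) * cnj_eis (chi (1 - int s)))"
  let ?C = "\<lambda>u. \<Sum>s<q. chi (int s) * cnj_eis (chi (u - int s))"
  have 0: "?C u = of_nat (q - 1)" if u: "int q dvd u" for u
  proof -
    have "?C u = (\<Sum>s<q. if int q dvd int s then 0 else 1)"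
    proof (intro sum.cong refl)
      fix s
      have "[u - int s = - int s] (mod int q)" using u by (simp add: cong_iff_dvd_diff)
      then have "chi (u - int s) = chi (int s)" using chi_cong chi_minus by metis
      then show "chi (int s) * cnj_eis (chi (u - int s)) = (if int q dvd int s then 0 else 1)"
        by (simp only: chi_mult_cnj)
    qed
    then show ?thesis by (simp only: sum_D_type) simp
  qed
  have 1: "?C u = K" if u: "\<not> int q dvd u" for u
  proof -
    have "?C u = chi u * (\<Sum>s<q. chi (int s) * cnj_eis (chi (u * (1 - int s))))"
      by (rule sum_twisted[OF u periodic_chi(2)])
    also have "\<dots> = (chi u * cnj_eis (chi u)) * K"
      by (simp add: K_def chi_mult sum_distrib_left mult_ac)
    finally show ?thesis using u by (simp add: chi_mult_cnj)
  qed
  \<comment> \<open>All values at nonzero residues equal one constant \<open>K\<close>. The total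
    over \<open>u\<close> vanishes because the double sum factors through a character sum, and this
    forces K = -1.\<close>
  have "(\<Sum>u<q. ?C (int u)) = (\<Sum>s<q. chi (int s) * (\<Sum>u<q. cnj_eis (chi (int u - int s))))"
    by (subst sum.swap) (simp add: sum_distrib_left)
  also have "\<dots> = 0"
  proof (intro sum.neutral ballI)
    fix s
    have "(\<Sum>u<q. chi (int u - int s)) = (\<Sum>u<q. chi (int s - int u))"
      by (metis chi_minus minus_diff_eq)
    then have "(\<Sum>u<q. cnj_eis (chi (int u - int s))) = 0"
      using sum_chi_shift by (simp flip: cnj_eis_sum)
    then show "chi (int s) * (\<Sum>u<q. cnj_eis (chi (int u - int s))) = 0" by simp
  qed
  finally have "(\<Sum>u<q. ?C (int u)) = 0" .
  moreover have "(\<Sum>u<q. ?C (int u)) = (\<Sum>u<q. if int q dvd int u then of_nat (q - 1) else K)"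
    using 0 1 by (intro sum.cong) auto
  ultimately have "of_nat (q - 1) + of_nat (q - 1) * K = 0"
    using sum_D_type[of "of_nat (q - 1)" K] by metis
  then have "of_nat (q - 1) * (1 + K) = 0"
    by (simp only: distrib_left mult_1_right)
  moreover have "of_nat (q - 1) \<noteq> (0 :: eis)"
    using q_gt1 by (simp add: eis_eq_iff)
  ultimately have "K = -1" by (simp add: add_eq_0_iff)
  then show ?thesis using 0 1 q_gt1 by (auto simp: of_nat_diff)
qed

text \<open>The all-ones part of \<open>D\<close> contributes a complete sum of \<open>chi\<close>,
  which is zero; this is why \<open>D\<close> acts on \<open>P\<close> as the scalar q.\<close>

lemma conv_D_chi: "(\<Sum>s<q. D (int s) * chi (u - int s)) = of_nat q * chi u"
proof -
  have "(\<Sum>s<q. D (int s) * chi (u - int s)) =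
      (\<Sum>s<q. if s = 0 then of_nat q * chi u else 0) - (\<Sum>s<q. chi (u - int s))"
    unfolding sum_subtractf[symmetric]
    by (intro sum.cong) (auto simp: algebra_simps dest: dvd_imp_le)
  then show ?thesis using q_pos sum_chi_shift by simp
qed

lemma P_P: "dvdcong (cyc q) (P * P) ([:J:] * Q)"
  using gpoly_mult[OF q_pos periodic_chi(1) periodic_chi(1)]
  by (simp only: conv_chi_chi gpoly_scale)

lemma P_Q: "dvdcong (cyc q) (P * Q) (gpoly q D)"
  using gpoly_mult[OF q_pos periodic_chi(1) periodic_chi(2)]
  by (simp only: conv_chi_cnj)

lemma D_P: "dvdcong (cyc q) (gpoly q D * P) ([:of_nat q:] * P)"
  using gpoly_mult[OF q_pos periodic_D periodic_chi(1)]
  by (simp only: conv_D_chi gpoly_scale)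

lemma P_cube: "dvdcong (cyc q) (P ^ 3) ([:J:] * gpoly q D)"
proof -
  have "dvdcong (cyc q) (P * P * P) ([:J:] * Q * P)"
    by (intro dvdcong_mult P_P dvdcong_refl)
  also have "[:J:] * Q * P = [:J:] * (P * Q)" by (simp only: mult_ac)
  also have "dvdcong (cyc q) \<dots> ([:J:] * gpoly q D)"
    by (intro dvdcong_mult P_Q dvdcong_refl)
  finally show ?thesis by (simp only: power3_eq_cube)
qed

lemma P_pow4: "dvdcong (cyc q) (P ^ 3 * P) ([:of_nat q * J:] * P)"
proof -
  have "dvdcong (cyc q) (P ^ 3 * P) ([:J:] * gpoly q D * P)"
    by (intro dvdcong_mult P_cube dvdcong_refl)
  also have "[:J:] * gpoly q D * P = [:J:] * (gpoly q D * P)" by (simp only: mult_ac)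
  also have "dvdcong (cyc q) \<dots> ([:J:] * ([:of_nat q:] * P))"
    by (intro dvdcong_mult D_P dvdcong_refl)
  also have "[:J:] * ([:of_nat q:] * P) = [:of_nat q * J:] * P"
    by (simp add: mult.commute)
  finally show ?thesis .
qed

lemma P_power: "dvdcong (cyc q) (P ^ (3 * k + 1)) (gpoly q (\<lambda>u. (of_nat q * J) ^ k * chi u))"
proof (induction k)
  case (Suc k)
  have "P ^ (3 * Suc k + 1) = P ^ 3 * P ^ (3 * k + 1)"
    unfolding power_add[symmetric] by (simp add: add.commute)
  also have "dvdcong (cyc q) \<dots> (P ^ 3 * ([:(of_nat q * J) ^ k:] * P))"
    using Suc by (intro dvdcong_mult dvdcong_refl) (simp only: gpoly_scale)
  also have "P ^ 3 * ([:(of_nat q * J) ^ k:] * P) = [:(of_nat q * J) ^ k:] * (P ^ 3 * P)"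
    by (simp only: mult_ac)
  also have "dvdcong (cyc q) \<dots> ([:(of_nat q * J) ^ k:] * ([:of_nat q * J:] * P))"
    by (intro dvdcong_mult P_pow4 dvdcong_refl)
  also have "\<dots> = gpoly q (\<lambda>u. (of_nat q * J) ^ Suc k * chi u)"
    unfolding gpoly_scale by (simp add: mult.commute)
  finally show ?case .
qed simp

lemma P_power2:
  "dvdcong (cyc q) (P ^ (3 * k + 2)) (gpoly q (\<lambda>u. (of_nat q * J) ^ k * J * cnj_eis (chi u)))"
proof -
  have "P ^ (3 * k + 2) = P ^ (3 * k + 1) * P" by simp
  also have "dvdcong (cyc q) \<dots> ([:(of_nat q * J) ^ k:] * P * P)"
    using P_power by (intro dvdcong_mult dvdcong_refl) (simp only: gpoly_scale)
  also have "[:(of_nat q * J) ^ k:] * P * P = [:(of_nat q * J) ^ k:] * (P * P)"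
    by (simp only: mult_ac)
  also have "dvdcong (cyc q) \<dots> ([:(of_nat q * J) ^ k:] * ([:J:] * Q))"
    by (intro dvdcong_mult P_P dvdcong_refl)
  also have "\<dots> = gpoly q (\<lambda>u. (of_nat q * J) ^ k * J * cnj_eis (chi u))"
    by (simp only: gpoly_scale mult.assoc)
  finally show ?thesis .
qed

lemma J_cnj: "(\<Sum>s<q. cnj_eis (chi (int s)) * cnj_eis (chi (1 - int s))) = cnj_eis J"
  by (simp add: J_def cnj_eis_sum)

text \<open>\<open>P * P * Q\<close> is evaluated twice: as J Q Q, which is the norm of J times P,
  and as (P Q) P, which is q P. The coefficients of X are then compared.\<close>

lemma enorm_J: "enorm J = int q"
proof -
  interpret c: cubic_character q "\<lambda>a. cnj_eis (chi a)" by (rule cubic_character_cnj)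
  have cJ: "c.J = cnj_eis J" unfolding c.J_def by (rule J_cnj)
  have QQ: "dvdcong (cyc q) (Q * Q) ([:cnj_eis J:] * P)"
    using c.P_P by (simp add: cJ)
  have "dvdcong (cyc q) (P * P * Q) ([:J:] * Q * Q)"
    by (intro dvdcong_mult P_P dvdcong_refl)
  also have "[:J:] * Q * Q = [:J:] * (Q * Q)" by (simp only: mult_ac)
  also have "dvdcong (cyc q) \<dots> ([:J:] * ([:cnj_eis J:] * P))"
    by (intro dvdcong_mult QQ dvdcong_refl)
  also have "\<dots> = gpoly q (\<lambda>u. of_int (enorm J) * chi u)"
    unfolding gpoly_scale by (simp add: mult_cnj_eis[symmetric] mult.commute)
  finally have 1: "dvdcong (cyc q) (P * P * Q) \<dots>" .
  have "dvdcong (cyc q) (P * Q * P) (gpoly q D * P)"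
    by (intro dvdcong_mult P_Q dvdcong_refl)
  also have "dvdcong (cyc q) \<dots> ([:of_nat q:] * P)" by (rule D_P)
  also have "P * Q * P = P * P * Q" by (simp only: mult_ac)
  finally have "dvdcong (cyc q) (P * P * Q) (gpoly q (\<lambda>u. of_nat q * chi u))"
    by (simp only: gpoly_scale)
  with 1 have "dvdcong (cyc q) (gpoly q (\<lambda>u. of_int (enorm J) * chi u)) (gpoly q (\<lambda>u. of_nat q * chi u))"
    using dvdcong_sym dvdcong_trans by blast
  from gpoly_inj[OF this q_gt1] show ?thesis
    by (simp add: chi_1 eis_eq_iff)
qed

text \<open>The coefficient of X^3 in P^3 is J times the value -1 of \<open>D\<close>, while cubing
  coefficientwise gives chi(1)^3 = 1 modulo 3.\<close>

lemma J_mod_3: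
  assumes "q \<noteq> 3"
  shows "dvdcong 3 J (-1)"
proof -
  have "\<not> int q dvd int 3"
    using assms prime_q primes_dvd_imp_eq[OF prime_q prime_3_nat] by (simp only: int_dvd_int_iff) blast
  then have nd: "\<not> int q dvd int (3 mod q)"
    by (simp add: dvd_mod_iff of_nat_mod)
  have "dvdcong (of_nat 3) ((\<lambda>u. J * D u) (int (3 mod q))) (chi 1 ^ 3)"
  proof (rule gpoly_frobenius)
    show "dvdcong (cyc q) (P ^ 3) (gpoly q (\<lambda>u. J * D u))"
      using P_cube by (simp only: gpoly_scale)
    show "coprime 3 q"
      using assms prime_q primes_coprime prime_3_nat by blast
    show "[int 3 * 1 = int (3 mod q)] (mod int q)" by (simp add: cong_def of_nat_mod)
  qed (use periodic_chi q_pos prime_3_nat in auto)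
  then have "dvdcong 3 (- J) 1" using nd by (simp add: chi_1)
  from dvdcong_minus[OF this] show ?thesis by simp
qed

text \<open>The coefficient of X^c in P^c is chi(1)^c = 1 modulo \<open>c\<close>, which gives a
  congruence for a power of qJ. Comparison with the conjugate congruence removes the power of q and
  leaves the quotient that defines the symbol.\<close>

lemma cubic_symbol_J:
  assumes "prime c" "c \<noteq> 3" "c \<noteq> q"
  shows "cubic_symbol c J (chi (int c))"
proof -
  have cop: "coprime c q" using assms prime_q primes_coprime by blast
  have nd: "\<not> int q dvd int c"
    using assms prime_q primes_dvd_imp_eq by auto
  note unit = chi_unit[OF nd]
  have cm: "[int c * 1 = int (c mod q)] (mod int q)" by (simp add: cong_def of_nat_mod)
  have cmod: "chi (int (c mod q)) = chi (int c)" by (simp add: of_nat_mod chi_mod)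
  define k where "k = c div 3"
  have "coprime (enorm (of_nat q)) (int c)"
    using cop enorm_of_int[of "int q"] by (simp add: coprime_commute)
  then obtain e :: eis where e0: "dvdcong (of_nat c) (e * of_nat q) 1"
    using dvdcong_unit_eis by blast
  have e: "dvdcong (of_nat c) (e ^ k * of_nat q ^ k) 1"
    using dvdcong_power[OF e0, of k] by (simp add: power_mult_distrib)
  have inv: "chi (int c) * cnj_eis (chi (int c)) = 1" using nd by (simp add: chi_mult_cnj)
  have cq: "cnj_eis (chi (int c)) ^ 2 = chi (int c)"
    using cube_unit_cube[OF unit] cube_unit_cube[OF unit]
    by (simp add: chi_sq[symmetric] power2_eq_square power3_eq_cube mult_ac)
  have "c mod 3 \<noteq> 0"
    using assms by (metis dvd_eq_mod_eq_0 primes_dvd_imp_eq prime_3_nat)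
  then consider "c mod 3 = 1" | "c mod 3 = 2" by linarith
  then show ?thesis
  proof cases
    case 1
    then have ck: "c = 3 * k + 1" unfolding k_def by presburger
    have "dvdcong (of_nat c) ((\<lambda>u. (of_nat q * J) ^ k * chi u) (int (c mod q))) (chi 1 ^ c)"
    proof (rule gpoly_frobenius[OF assms(1) cop q_pos periodic_chi(1) _ _ cm])
      show "dvdcong (cyc q) (P ^ c) (gpoly q (\<lambda>u. (of_nat q * J) ^ k * chi u))"
        using P_power[of k] ck by simp
    qed (use q_pos in auto)
    then have A: "dvdcong (of_nat c) ((of_nat q * J) ^ k * chi (int c)) 1"
      by (simp add: chi_1 cmod)
    have B: "dvdcong (of_nat c) 1 ((of_nat q * cnj_eis J) ^ k * cnj_eis (chi (int c)))"
      using dvdcong_sym[OF dvdcong_cnj[OF A]] by simp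
    have "dvdcong (of_nat c) (cnj_eis (chi (int c)) * ((of_nat q * J) ^ k * chi (int c)))
       (cnj_eis (chi (int c)) * ((of_nat q * cnj_eis J) ^ k * cnj_eis (chi (int c))))"
      by (intro dvdcong_mult dvdcong_refl dvdcong_trans[OF A B])
    moreover have "cnj_eis (chi (int c)) * ((of_nat q * J) ^ k * chi (int c)) = of_nat q ^ k * J ^ k"
      using inv by (simp add: power_mult_distrib mult_ac)
    moreover have "cnj_eis (chi (int c)) * ((of_nat q * cnj_eis J) ^ k * cnj_eis (chi (int c))) =
       of_nat q ^ k * (chi (int c) * cnj_eis J ^ k)"
      by (subst cq[symmetric]) (simp add: power_mult_distrib power2_eq_square mult_ac)
    ultimately have "dvdcong (of_nat c) (J ^ k) (chi (int c) * cnj_eis J ^ k)"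
      using dvdcong_cancel_left e by metis
    then show ?thesis
      unfolding cubic_symbol_def using 1 unit by (auto simp flip: k_def intro: dvdcong_sym)
  next
    case 2
    then have ck: "c = 3 * k + 2" unfolding k_def by presburger
    have "dvdcong (of_nat c) ((\<lambda>u. (of_nat q * J) ^ k * J * cnj_eis (chi u)) (int (c mod q))) (chi 1 ^ c)"
    proof (rule gpoly_frobenius[OF assms(1) cop q_pos periodic_chi(1) _ _ cm])
      show "dvdcong (cyc q) (P ^ c) (gpoly q (\<lambda>u. (of_nat q * J) ^ k * J * cnj_eis (chi u)))"
        using P_power2[of k] ck by simp
    qed (use q_pos in auto)
    then have A: "dvdcong (of_nat c) ((of_nat q * J) ^ k * J * cnj_eis (chi (int c))) 1"
      by (simp add: chi_1 cmod)
    have B: "dvdcong (of_nat c) 1 ((of_nat q * cnj_eis J) ^ k * cnj_eis J * chi (int c))"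
      using dvdcong_sym[OF dvdcong_cnj[OF A]] by simp
    have "dvdcong (of_nat c) (cnj_eis (chi (int c)) * ((of_nat q * J) ^ k * J * cnj_eis (chi (int c))))
       (cnj_eis (chi (int c)) * ((of_nat q * cnj_eis J) ^ k * cnj_eis J * chi (int c)))"
      by (intro dvdcong_mult dvdcong_refl dvdcong_trans[OF A B])
    moreover have "cnj_eis (chi (int c)) * ((of_nat q * J) ^ k * J * cnj_eis (chi (int c))) =
        of_nat q ^ k * (chi (int c) * J ^ (k + 1))"
      by (subst (3) cq[symmetric]) (simp add: power_mult_distrib power2_eq_square mult_ac)
    moreover have "cnj_eis (chi (int c)) * ((of_nat q * cnj_eis J) ^ k * cnj_eis J * chi (int c)) =
       of_nat q ^ k * cnj_eis J ^ (k + 1)"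
      using inv by (simp add: power_mult_distrib mult_ac)
    ultimately have "dvdcong (of_nat c) (chi (int c) * J ^ (k + 1)) (cnj_eis J ^ (k + 1))"
      using dvdcong_cancel_left e by metis
    then show ?thesis
      unfolding cubic_symbol_def using 2 unit by (auto simp flip: k_def)
  qed
qed

end

section \<open>Existence of cubic characters, and prime divisors of norms\<close>

text \<open>The character is omega to the discrete logarithm for a primitive root, well defined
  because 3 divides q - 1.\<close>

lemma cubic_character_exists:
  assumes "prime q" "q mod 3 = 1"
  shows "\<exists>chi. cubic_character q chi"
proof -
  have q1: "q > 1" using assms(1) prime_gt_1_nat by blast
  obtain g where g: "residue_primroot q g"
    using prime_primitive_root_exists[of q] assms q1 by auto
  then have cop: "coprime q g" and ord: "ord q g = q - 1"
    using assms(1) by (auto simp: residue_primroot_def totient_prime)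
  have log: "\<exists>k. [int g ^ k = a] (mod int q)" if "\<not> int q dvd a" for a
  proof -
    have "nat (a mod int q) \<in> totatives q"
    proof -
      have "coprime (int q) a" using that assms(1) by (simp add: prime_imp_coprime)
      then have "coprime (int q) (a mod int q)" using q1 by (simp add: coprime_commute)
      moreover have "a mod int q > 0"
        using that q1 by (simp add: dvd_eq_mod_eq_0 order_less_le)
      ultimately obtain r where r: "a mod int q = int r" "r > 0" "coprime (int q) (int r)"
        by (metis pos_int_cases of_nat_0_less_iff)
      then have "r \<le> q" using q1 by (metis less_imp_le of_nat_less_iff of_nat_0_less_iff pos_mod_bound gr_implies_not0 gr0I)
      then show ?thesis
        using r by (simp add: totatives_def coprime_commute)
    qed
    then obtain k where "nat (a mod int q) = g ^ k mod q"
      using bij_betw_imp_surj_on[OF residue_primroot_is_generator[OF q1 g]] by blast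
    then have "a mod int q = int (g ^ k mod q)"
      using q1 by (metis int_nat_eq pos_mod_sign of_nat_0_less_iff less_trans zero_less_one)
    then show ?thesis by (metis cong_def of_nat_mod of_nat_power)
  qed
  define L where "L = (\<lambda>a. SOME k. [int g ^ k = a] (mod int q))"
  have L: "[int g ^ L a = a] (mod int q)" if "\<not> int q dvd a" for a
    unfolding L_def using log[OF that] by (rule someI_ex)
  have eqL: "omega ^ j = omega ^ k" if "[int g ^ j = int g ^ k] (mod int q)" for j k
  proof -
    have "[g ^ j = g ^ k] (mod q)"
      using that by (metis cong_int_iff of_nat_power)
    then have "[j = k] (mod (q - 1))"
      using order_divides_expdiff[OF cop] ord by simp
    moreover have "3 dvd q - 1" using assms(2) by presburger
    ultimately have "j mod 3 = k mod 3"
      using cong_dvd_modulus_nat unfolding cong_def by blast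
    then show ?thesis
      using cube_unit_power_mod3[OF cube_unit_simps(2)] by metis
  qed
  define chi where "chi = (\<lambda>a. if int q dvd a then 0 else omega ^ L a)"
  have pr: "prime (int q)" using assms(1) by simp
  have "cubic_character q chi"
  proof
    fix a b
    show "chi (a * b) = chi a * chi b"
    proof (cases "int q dvd a \<or> int q dvd b")
      case False
      then have ab: "\<not> int q dvd a * b" using pr by (simp add: prime_dvd_mult_iff)
      have "[int g ^ L (a * b) = a * b] (mod int q)" by (rule L[OF ab])
      also have "[a * b = int g ^ L a * int g ^ L b] (mod int q)"
        using L False by (intro cong_mult) (auto intro: cong_sym)
      finally have "omega ^ L (a * b) = omega ^ (L a + L b)"
        by (intro eqL) (simp add: power_add)
      then show ?thesis using False ab by (simp add: chi_def power_add)
    qed (auto simp: chi_def)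
  next
    fix a b assume ab: "[a = b] (mod int q)"
    show "chi a = chi b"
    proof (cases "int q dvd a")
      case True
      then show ?thesis using cong_dvd_iff[OF ab] by (simp add: chi_def)
    next
      case False
      then have b: "\<not> int q dvd b" using cong_dvd_iff[OF ab] by simp
      have "[int g ^ L a = int g ^ L b] (mod int q)"
        using L[OF False] L[OF b] ab by (metis cong_sym cong_trans)
      then show ?thesis using False b eqL by (simp add: chi_def)
    qed
  next
    have g: "\<not> int q dvd int g"
    proof
      assume "int q dvd int g"
      then have "is_unit q" using cop by (simp add: coprime_absorb_left)
      then show False using q1 by simp
    qed
    have "chi (int g) = omega ^ 1"
      using g L[OF g] eqL[of "L (int g)" 1] by (simp add: chi_def)
    then show "\<exists>a. chi a \<noteq> 0 \<and> chi a \<noteq> 1"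
      by (intro exI[of _ "int g"]) (simp add: eis_eq_iff)
  qed (use assms in \<open>auto simp: chi_def\<close>)
  then show ?thesis by blast
qed

lemma fermat_theorem_int:
  assumes "prime q" "\<not> int q dvd x"
  shows "[x ^ (q - 1) = 1] (mod int q)"
proof -
  define y where "y = nat (x mod int q)"
  have xy: "[x = int y] (mod int q)"
    using prime_gt_0_nat[OF assms(1)] by (simp add: y_def cong_def)
  then have "\<not> q dvd y" using assms(2) cong_dvd_iff[OF xy] by simp
  then have "[y ^ (q - 1) = 1] (mod q)" using fermat_theorem assms(1) by blast
  then have "[int y ^ (q - 1) = 1] (mod int q)" by (metis cong_int_iff of_nat_power of_nat_1)
  then show ?thesis using cong_pow[OF xy] cong_trans by blast
qed

text \<open>If q = 3k + 2, cubing is injective modulo q. A zero of the norm gives a^3 = (-b)^3,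
  hence a = -b, and the norm becomes 3b^2, against primitivity.\<close>

lemma prime_dvd_enorm_mod3:
  assumes "prime q" "int q dvd enorm A" "coprime (ere A) (eim A)" "q \<noteq> 3"
  shows "q mod 3 = 1"
proof (rule ccontr)
  define a b where ab: "a = ere A" "b = eim A"
  assume "q mod 3 \<noteq> 1"
  moreover have "q mod 3 \<noteq> 0"
    using assms by (metis dvd_eq_mod_eq_0 primes_dvd_imp_eq prime_3_nat)
  ultimately have "q mod 3 = 2" by linarith
  then obtain k where k: "q = 3 * k + 2"
    by (metis mod_mult_div_eq mult.commute add.commute)
  have pr: "prime (int q)" using assms by simp
  have fermat: "[x ^ q = x] (mod int q)" for x :: int
  proof (cases "int q dvd x")
    case True
    moreover have "int q dvd x ^ q" using True prime_gt_0_nat[OF assms(1)] by (simp add: dvd_power_le dvd_trans)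
    ultimately show ?thesis by (simp add: cong_iff_dvd_diff)
  next
    case False
    then have "[x ^ (q - 1) * x = 1 * x] (mod int q)"
      by (intro cong_mult cong_refl fermat_theorem_int assms)
    then show ?thesis
      using prime_gt_0_nat[OF assms(1)] by (simp add: power_eq_if mult.commute)
  qed
  \<comment> \<open>3(2k + 1) = q + (q - 1), so this power inverts cubing modulo q.\<close>
  have cube: "[(x ^ 3) ^ (2 * k + 1) = x] (mod int q)" for x :: int
  proof -
    have "(x ^ 3) ^ (2 * k + 1) = x ^ q * x ^ (q - 1)"
      unfolding power_mult[symmetric] power_add[symmetric] k by (rule arg_cong) simp
    also have "[\<dots> = x * x ^ (q - 1)] (mod int q)" by (intro cong_mult fermat cong_refl)
    also have "x * x ^ (q - 1) = x ^ q" using k by simp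
    also have "[x ^ q = x] (mod int q)" by (rule fermat)
    finally show ?thesis .
  qed
  have "a ^ 3 - (- b) ^ 3 = (a + b) * enorm A"
    by (simp add: ab enorm_def power2_eq_square power3_eq_cube algebra_simps)
  then have "[a ^ 3 = (- b) ^ 3] (mod int q)"
    using assms(2) by (simp add: cong_iff_dvd_diff del: power_minus_odd)
  from cong_pow[OF this] have "[a = - b] (mod int q)"
    using cube by (meson cong_sym cong_trans)
  then have s: "int q dvd a + b" by (simp add: cong_iff_dvd_diff)
  have "3 * b\<^sup>2 = enorm A - (a + b) * (a - 2 * b)"
    by (simp add: ab enorm_def power2_eq_square algebra_simps)
  then have "int q dvd 3 * b\<^sup>2" using s assms(2) by simp
  moreover have "\<not> int q dvd 3"
    using assms primes_dvd_imp_eq[OF assms(1) prime_3_nat] by (metis int_dvd_int_iff of_nat_numeral)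
  ultimately have "int q dvd b" using pr by (meson prime_dvd_mult_iff prime_dvd_power)
  moreover from this s have "int q dvd a" by (simp add: dvd_add_left_iff)
  ultimately have "int q dvd 1" using assms(3) unfolding ab[symmetric] by (meson coprime_common_divisor)
  then show False using pr not_prime_unit by blast
qed

text \<open>A substitute for unique factorization: the omega-coordinates of
  \<open>A * cnj_eis z\<close> and \<open>A * z\<close> have a product that combines two norms
  divisible by q. Once one of these coordinates is divisible by q, the norm forces the other
  coordinate of that element as well.\<close>

lemma prime_enorm_dvd:
  assumes "prime q" "int q dvd enorm A" "enorm z = int q"
  shows "z dvd A \<or> cnj_eis z dvd A"
proof -
  have pr: "prime (int q)" using assms by simp
  have conclude: "y dvd A" if y: "enorm y = int q" and im: "int q dvd eim (A * cnj_eis y)" for y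
  proof -
    let ?w = "A * cnj_eis y"
    have "int q dvd enorm ?w" using assms(2) by (simp add: enorm_mult)
    moreover have "(ere ?w)\<^sup>2 = enorm ?w + eim ?w * (ere ?w - eim ?w)"
      by (simp only: enorm_def power2_eq_square algebra_simps)
    ultimately have "int q dvd (ere ?w)\<^sup>2" using im by simp
    then have "int q dvd ere ?w" using pr prime_dvd_power by blast
    then have "of_int (int q) dvd ?w" using im of_int_dvd_eis_iff by blast
    then obtain B where "?w = of_int (int q) * B" by (elim dvdE)
    then have "A * cnj_eis y = (y * B) * cnj_eis y"
      unfolding y[symmetric] mult_cnj_eis[symmetric] by (simp only: mult_ac)
    moreover have "cnj_eis y \<noteq> 0"
      using y prime_gt_0_nat[OF assms(1)] by (metis enorm_cnj enorm_eq_0 of_nat_0_eq_iff less_irrefl)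
    ultimately have "A = y * B" by simp
    then show ?thesis by simp
  qed
  have "eim (A * cnj_eis z) * eim (A * z) = (eim A)\<^sup>2 * enorm z - (eim z)\<^sup>2 * enorm A"
    by (simp add: enorm_def power2_eq_square algebra_simps)
  then have "int q dvd eim (A * cnj_eis z) * eim (A * z)" using assms by simp
  then consider "int q dvd eim (A * cnj_eis z)" | "int q dvd eim (A * cnj_eis (cnj_eis z))"
    using pr by (auto simp: prime_dvd_mult_iff)
  then show ?thesis
    using conclude[of z] conclude[of "cnj_eis z"] assms(3) by cases auto
qed

subsection \<open>Cubic reciprocity for primary Eisenstein integers and rational primes\<close>

text \<open>\<open>psi\<close> plays the role of the cubic residue character $c \mapsto (c/A)_3$ on the rational integers;
  the last conjunct is the reciprocity law $(A/c)_3 = (c/A)_3$.\<close>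
definition reciprocal :: "eis \<Rightarrow> (int \<Rightarrow> eis) \<Rightarrow> bool" where
  "reciprocal A psi \<longleftrightarrow> (\<forall>a b. psi (a * b) = psi a * psi b) \<and>
     (\<forall>a b. [a = b] (mod enorm A) \<longrightarrow> psi a = psi b) \<and>
     (\<forall>a. coprime a (enorm A) \<longrightarrow> cube_unit (psi a)) \<and>
     (\<forall>c. prime c \<longrightarrow> c \<noteq> 3 \<longrightarrow> \<not> int c dvd enorm A \<longrightarrow> cubic_symbol c A (psi (int c)))"

text \<open>Induction on the norm. A prime q dividing it is 1 modulo 3, and a Jacobi sum of norm q
  divides \<open>A\<close>. As that sum is -1 modulo 3, the quotient is again primary. The
  characters belonging to the factors multiply to \<open>psi\<close>.\<close>

lemma reciprocal_exists:
  assumes "coprime (ere A) (eim A)" "3 dvd eim A"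
  shows "\<exists>psi. reciprocal A psi"
  using assms
proof (induction "nat (enorm A)" arbitrary: A rule: less_induct)
  case less
  note cop = less.prems(1) and prim = less.prems(2)
  have "A \<noteq> 0" using cop by auto
  then have N: "enorm A > 0" using enorm_nonneg[of A] enorm_eq_0[of A] by linarith
  show ?case
  proof (cases "enorm A = 1")
    case True
    \<comment> \<open>A nonzero multiple of 3 in this place would make four times the norm at least
      27.\<close>
    have "eim A = 0"
    proof (rule ccontr)
      assume "eim A \<noteq> 0"
      then have "\<bar>eim A\<bar> \<ge> 3" using prim dvd_imp_le_int by force
      then have "\<bar>eim A\<bar>\<^sup>2 \<ge> 3\<^sup>2" by (intro power_mono) auto
      then show False using four_enorm[of A] True zero_le_power2[of "2 * ere A - eim A"] by simp
    qed
    then have A: "A = of_int (ere A)" by (simp add: eis_eq_iff)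
    have "reciprocal A (\<lambda>_. 1)"
      unfolding reciprocal_def using cubic_symbol_of_int[of _ "ere A"] A by simp
    then show ?thesis by blast
  next
    case False
    then obtain q' where "prime q'" "q' dvd enorm A"
      using prime_divisor_exists[of "enorm A"] N by auto
    then obtain q where q: "prime q" "int q dvd enorm A"
      by (metis prime_int_nat_transfer prime_ge_0_int int_nat_eq)
    have pr: "prime (int q)" using q by simp
    have q3: "q \<noteq> 3"
    proof
      assume "q = 3"
      then have "3 dvd (ere A)\<^sup>2 - ere A * eim A + (eim A)\<^sup>2" using q by (simp add: enorm_def)
      moreover have "(ere A)\<^sup>2 = ((ere A)\<^sup>2 - ere A * eim A + (eim A)\<^sup>2) + eim A * (ere A - eim A)"
        by (simp add: power2_eq_square algebra_simps)
      ultimately have "3 dvd (ere A)\<^sup>2" using prim by (metis dvd_add dvd_mult2)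
      then have "3 dvd ere A" using prime_dvd_power[of "3::int"] pr \<open>q = 3\<close> by auto
      then show False using cop prim by (auto dest: coprime_common_divisor)
    qed
    have "q mod 3 = 1" by (rule prime_dvd_enorm_mod3[OF q cop q3])
    then obtain chi0 where chi0: "cubic_character q chi0"
      using cubic_character_exists q by blast
    interpret c0: cubic_character q chi0 by (rule chi0)
    interpret c1: cubic_character q "\<lambda>a. cnj_eis (chi0 a)" by (rule c0.cubic_character_cnj)
    have "c1.J = cnj_eis c0.J" unfolding c1.J_def by (rule c0.J_cnj)
    \<comment> \<open>Passing to the conjugate character conjugates the Jacobi sum, so one of the
      two characters has a Jacobi sum dividing \<open>A\<close>.\<close>
    then obtain chi where chi: "cubic_character q chi" and dvd: "cubic_character.J q chi dvd A"
      using prime_enorm_dvd[OF q c0.enorm_J] chi0 c0.cubic_character_cnj by metis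
    interpret c: cubic_character q chi by (rule chi)
    obtain B where B: "A = c.J * B" using dvd by (elim dvdE)
    have NB: "enorm A = int q * enorm B" by (simp add: B enorm_mult c.enorm_J)
    have "enorm B > 0" using N NB c.q_pos by (simp add: zero_less_mult_iff)
    then have lt: "nat (enorm B) < nat (enorm A)" using NB c.q_gt1 by simp
    have copB: "coprime (ere B) (eim B)"
    proof (rule coprimeI)
      fix d assume "d dvd ere B" "d dvd eim B"
      then have "of_int d dvd B" by (simp add: of_int_dvd_eis_iff)
      then have "of_int d dvd A" using B by simp
      then show "is_unit d" using cop by (auto simp: of_int_dvd_eis_iff dest: coprime_common_divisor)
    qed
    have "dvdcong 3 A (-1 * B)"
      unfolding B by (intro dvdcong_mult c.J_mod_3[OF q3] dvdcong_refl)
    then have "of_nat 3 dvd A + B" by (simp add: dvdcong_def)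
    then have "3 dvd eim A + eim B" by (simp only: of_nat_dvd_eis_iff eis_sel) simp
    then have primB: "3 dvd eim B" using prim by (simp add: dvd_add_right_iff)
    obtain psi where psi: "reciprocal B psi" using less.hyps[OF lt copB primB] by blast
    have "reciprocal A (\<lambda>a. chi a * psi a)"
      unfolding reciprocal_def
    proof (intro conjI allI impI)
      fix a b
      show "chi (a * b) * psi (a * b) = chi a * psi a * (chi b * psi b)"
        using psi by (simp add: reciprocal_def c.chi_mult mult_ac)
    next
      fix a b assume "[a = b] (mod enorm A)"
      then have "[a = b] (mod int q)" "[a = b] (mod enorm B)"
        using NB by (auto intro: cong_dvd_modulus)
      then show "chi a * psi a = chi b * psi b"
        using c.chi_cong psi by (metis reciprocal_def)
    next
      fix a assume a: "coprime a (enorm A)"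
      then have "coprime a (enorm B)" "coprime a (int q)" by (simp_all add: NB)
      moreover from this(2) have "\<not> int q dvd a"
        using pr by (metis coprime_absorb_right coprime_commute not_prime_unit)
      ultimately show "cube_unit (chi a * psi a)"
        using c.chi_unit psi by (auto simp: reciprocal_def)
    next
      fix p assume p: "prime p" "p \<noteq> 3" "\<not> int p dvd enorm A"
      then have "\<not> int p dvd enorm B" "p \<noteq> q" using NB by auto
      then show "cubic_symbol p A (chi (int p) * psi (int p))"
        unfolding B using c.cubic_symbol_J p psi
        by (intro cubic_symbol_mult) (auto simp: reciprocal_def)
    qed
    then show ?thesis by blast
  qed
qed

subsection \<open>Supplementary laws\<close>

text \<open>\<open>kappa\<close> is the character modulo 9 with \<open>kappa (\<plusminus>(3 * k + 1)) = omega\<^sup>-\<^sup>k\<close>.\<close>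
definition kappa :: "int \<Rightarrow> eis" where
  "kappa a = (if a mod 9 \<in> {1, 8} then 1 else if a mod 9 \<in> {4, 5} then omega ^ 2
     else if a mod 9 \<in> {2, 7} then omega else 0)"

lemma mod9_cases:
  fixes a :: int
  obtains "a mod 9 = 0" | "a mod 9 = 1" | "a mod 9 = 2" | "a mod 9 = 3" | "a mod 9 = 4"
    | "a mod 9 = 5" | "a mod 9 = 6" | "a mod 9 = 7" | "a mod 9 = 8"
proof -
  have "0 \<le> a mod 9" "a mod 9 < 9" by simp_all
  then show thesis using that by linarith
qed

lemma omega_products:
  "omega * omega = omega\<^sup>2" "omega * omega\<^sup>2 = 1" "omega\<^sup>2 * omega = 1" "omega\<^sup>2 * omega\<^sup>2 = omega"
  by (simp_all add: eis_eq_iff power2_eq_square)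

lemma kappa_mult: "kappa (a * b) = kappa a * kappa b"
proof -
  have "a * b mod 9 = (a mod 9) * (b mod 9) mod 9" by (simp add: mod_mult_eq)
  then show ?thesis
    by (cases a rule: mod9_cases; cases b rule: mod9_cases)
      (simp_all add: kappa_def omega_products)
qed

lemma kappa_1 [simp]: "kappa 1 = 1" and kappa_minus1 [simp]: "kappa (-1) = 1"
  by (simp_all add: kappa_def)

lemma kappa_unit: "\<not> 3 dvd a \<Longrightarrow> cube_unit (kappa a)"
proof -
  assume "\<not> 3 dvd a"
  then have "a mod 9 \<noteq> 0" "a mod 9 \<noteq> 3" "a mod 9 \<noteq> 6" by presburger+
  then show ?thesis by (cases a rule: mod9_cases) (simp_all add: kappa_def cube_unit_def)
qed

lemma prime_mod3:
  assumes "prime (c::nat)" "c \<noteq> 3"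
  obtains k where "c = 3 * k + 1" | k where "c = 3 * k + 2"
proof -
  have "c mod 3 \<noteq> 0"
    using assms by (metis dvd_eq_mod_eq_0 primes_dvd_imp_eq prime_3_nat)
  then have "c = 3 * (c div 3) + 1 \<or> c = 3 * (c div 3) + 2" by presburger
  then show thesis using that by blast
qed

lemma mod3_cases:
  fixes k :: nat
  obtains j where "k = 3 * j" | j where "k = 3 * j + 1" | j where "k = 3 * j + 2"
proof -
  have "k = 3 * (k div 3) \<or> k = 3 * (k div 3) + 1 \<or> k = 3 * (k div 3) + 2" by presburger
  then show thesis using that by blast
qed

lemma omega_power_add: "omega ^ (3 * j + r) = omega ^ r"
  by (simp add: power_add power_mult)

text \<open>These exponents are what \<open>cubic_symbol\<close> produces for omega: (omega /
  omega^2)^k for c = 3k + 1 and (omega^2 / omega)^(k+1) for c = 3k + 2. They depend on k modulo 3,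
  that is on c modulo 9.\<close>

lemma kappa_exponent:
  "kappa (int (3 * k + 1)) = omega ^ (2 * k)" "kappa (int (3 * k + 2)) = omega ^ (k + 1)"
proof -
  have kap: "kappa (int (9 * j + r)) = kappa (int r)" for j r
    by (simp add: kappa_def)
  show "kappa (int (3 * k + 1)) = omega ^ (2 * k)"
  proof (cases k rule: mod3_cases)
    case (1 j)
    then have "3 * k + 1 = 9 * j + 1" "2 * k = 3 * (2 * j) + 0" by simp_all
    then show ?thesis by (simp only: kap omega_power_add) (simp add: kappa_def)
  next
    case (2 j)
    then have "3 * k + 1 = 9 * j + 4" "2 * k = 3 * (2 * j) + 2" by simp_all
    then show ?thesis by (simp only: kap omega_power_add) (simp add: kappa_def)
  next
    case (3 j)
    then have "3 * k + 1 = 9 * j + 7" "2 * k = 3 * (2 * j + 1) + 1" by simp_all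
    then show ?thesis by (simp only: kap omega_power_add) (simp add: kappa_def)
  qed
  show "kappa (int (3 * k + 2)) = omega ^ (k + 1)"
  proof (cases k rule: mod3_cases)
    case (1 j)
    then have "3 * k + 2 = 9 * j + 2" "k + 1 = 3 * j + 1" by simp_all
    then show ?thesis by (simp only: kap omega_power_add) (simp add: kappa_def)
  next
    case (2 j)
    then have "3 * k + 2 = 9 * j + 5" "k + 1 = 3 * j + 2" by simp_all
    then show ?thesis by (simp only: kap omega_power_add) (simp add: kappa_def)
  next
    case (3 j)
    then have "3 * k + 2 = 9 * j + 8" "k + 1 = 3 * (j + 1) + 0" by simp_all
    then show ?thesis by (simp only: kap omega_power_add) (simp add: kappa_def)
  qed
qed

lemma cnj_omega [simp]: "cnj_eis omega = omega ^ 2"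
  by (rule cube_unit_cnj) simp

lemma cubic_symbolI1:
  assumes "cube_unit u" "dvdcong (of_nat (3 * k + 1)) (u * cnj_eis z ^ k) (z ^ k)"
  shows "cubic_symbol (3 * k + 1) z u"
proof -
  have "(3 * k + 1) div 3 = k" "(3 * k + 1) mod 3 = 1" by presburger+
  then show ?thesis using assms by (simp only: cubic_symbol_def) simp
qed

lemma cubic_symbolI2:
  assumes "cube_unit u" "dvdcong (of_nat (3 * k + 2)) (u * z ^ (k + 1)) (cnj_eis z ^ (k + 1))"
  shows "cubic_symbol (3 * k + 2) z u"
proof -
  have "(3 * k + 2) div 3 = k" "(3 * k + 2) mod 3 \<noteq> 1" by presburger+
  then show ?thesis using assms by (simp only: cubic_symbol_def if_False)
qed

lemma cubic_symbol_omega: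
  assumes "prime c" "c \<noteq> 3"
  shows "cubic_symbol c omega (kappa (int c))"
  using assms
proof (cases rule: prime_mod3)
  case (1 k)
  have "omega ^ (2 * k) * (omega ^ 2) ^ k = (omega ^ 4) ^ k"
    unfolding power_mult[symmetric] power_add[symmetric] by (rule arg_cong) simp
  then show ?thesis
    unfolding 1 kappa_exponent by (intro cubic_symbolI1) auto
next
  case (2 k)
  have "omega ^ (k + 1) * omega ^ (k + 1) = (omega ^ 2) ^ (k + 1)"
    unfolding power_mult[symmetric] power_add[symmetric] by (rule arg_cong) simp
  then show ?thesis
    unfolding 2 kappa_exponent by (intro cubic_symbolI2) (auto simp del: power_Suc add_Suc_right)
qed

text \<open>The conjugate of 1 - omega is -omega^2 times it, so the symbol is a power of omega up to
  sign. The sign disappears for odd \<open>c\<close>, where the exponent is even, and is invisible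
  modulo 2.\<close>

lemma cubic_symbol_one_minus_omega:
  assumes "prime c" "c \<noteq> 3"
  shows "cubic_symbol c (1 - omega) (kappa (int c) ^ 2)"
  using assms
proof (cases rule: prime_mod3)
  case (1 k)
  have "even k"
    using assms(1) 1 prime_odd_nat[of c] prime_gt_1_nat[of c] by (cases "k = 0") auto
  then have sign: "(- 1 :: eis) ^ k = 1" by simp
  have "(1 - omega) ^ k = (- 1 * (omega * (1 - omega\<^sup>2))) ^ k"
    by (rule arg_cong[of _ _ "\<lambda>z. z ^ k"]) (simp add: eis_eq_iff omega_sq)
  also have "\<dots> = omega ^ k * (1 - omega\<^sup>2) ^ k"
    unfolding power_mult_distrib sign by simp
  also have "omega ^ k = (omega ^ (2 * k))\<^sup>2"
  proof -
    have "(omega ^ (2 * k))\<^sup>2 = (omega ^ 4) ^ k"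
      unfolding power_mult[symmetric] by (rule arg_cong) simp
    then show ?thesis by simp
  qed
  finally have "(1 - omega) ^ k = (omega ^ (2 * k))\<^sup>2 * (1 - omega\<^sup>2) ^ k" .
  then show ?thesis
    unfolding 1 kappa_exponent by (intro cubic_symbolI1) (simp_all add: cube_unit_power)
next
  case (2 k)
  have "(1 - omega\<^sup>2) ^ (k + 1) = (- 1 * (omega\<^sup>2 * (1 - omega))) ^ (k + 1)"
    by (rule arg_cong[of _ _ "\<lambda>z. z ^ (k + 1)"]) (simp add: eis_eq_iff omega_sq)
  also have "\<dots> = (- 1) ^ (k + 1) * ((omega\<^sup>2) ^ (k + 1) * (1 - omega) ^ (k + 1))"
    by (simp only: power_mult_distrib)
  also have "(omega\<^sup>2) ^ (k + 1) = (omega ^ (k + 1))\<^sup>2"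
    by (simp only: power_mult[symmetric] mult.commute)
  finally have eq: "(1 - omega\<^sup>2) ^ (k + 1) = (- 1) ^ (k + 1) * ((omega ^ (k + 1))\<^sup>2 * (1 - omega) ^ (k + 1))" .
  have "dvdcong (of_nat c) ((omega ^ (k + 1))\<^sup>2 * (1 - omega) ^ (k + 1)) ((1 - omega\<^sup>2) ^ (k + 1))"
  proof (cases "c = 2")
    case True
    have "dvdcong (of_nat c) z ((- 1) ^ (k + 1) * z)" for z :: eis
      using 2 True by (simp add: dvdcong_def of_nat_dvd_eis_iff)
    then show ?thesis unfolding eq .
  next
    case False
    then have "odd c" using assms(1) prime_odd_nat prime_ge_2_nat by (metis le_neq_implies_less)
    then have "even (k + 1)" using 2 by simp
    then have "(- 1 :: eis) ^ (k + 1) = 1" by (rule neg_one_even_power)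
    then show ?thesis unfolding eq by simp
  qed
  then show ?thesis
    unfolding 2 kappa_exponent
    by (intro cubic_symbolI2 cube_unit_power) (simp_all del: power_Suc add_Suc_right)
qed

text \<open>The element is sqrt(-3) = omega (1 - omega), and the symbols of the two factors
  cancel.\<close>

lemma cubic_symbol_sqrt_minus_3:
  assumes "prime c" "c \<noteq> 3"
  shows "cubic_symbol c (1 + 2 * omega) 1"
proof -
  have c3: "\<not> 3 dvd int c"
    using assms primes_dvd_imp_eq[OF prime_3_nat assms(1)] by (metis int_dvd_int_iff of_nat_numeral)
  have "kappa (int c) * kappa (int c) ^ 2 = 1"
    using cube_unit_cube[OF kappa_unit[OF c3]] by (simp add: power2_eq_square power3_eq_cube mult.assoc)
  moreover have "omega * (1 - omega) = 1 + 2 * omega"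
    by (simp add: eis_eq_iff)
  ultimately show ?thesis
    using cubic_symbol_mult[OF cubic_symbol_omega[OF assms] cubic_symbol_one_minus_omega[OF assms]] by simp
qed

subsection \<open>Values of the reciprocal character\<close>

lemma reciprocal_1: "reciprocal A psi \<Longrightarrow> psi 1 = 1"
  and reciprocal_minus1: "reciprocal A psi \<Longrightarrow> psi (-1) = 1"
proof -
  assume r: "reciprocal A psi"
  have u: "cube_unit (psi 1)" "cube_unit (psi (-1))"
    using r by (simp_all add: reciprocal_def)
  have "psi 1 * psi 1 = psi 1" using r unfolding reciprocal_def by (metis mult_1)
  then show 1: "psi 1 = 1" using cube_unit_nz[OF u(1)] by simp
  have "psi (-1) * psi (-1) = psi (-1 * -1)" using r unfolding reciprocal_def by metis
  then have "psi (-1) * psi (-1) = 1" using 1 by simp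
  then show "psi (-1) = 1"
    using cube_unit_cube[OF u(2)] by (simp add: power3_eq_cube)
qed

text \<open>Both sides are completely multiplicative and equal 1 at -1, so the prime divisors of
  \<open>a\<close> decide.\<close>

lemma reciprocal_eqI:
  assumes "reciprocal A psi" "a \<noteq> 0"
    and "\<And>r. prime r \<Longrightarrow> int r dvd a \<Longrightarrow> psi (int r) = kappa (int r) ^ j"
  shows "psi a = kappa a ^ j"
  using assms(2,3)
proof (induction a rule: prime_divisors_induct)
  case (unit a)
  then have "a = 1 \<or> a = -1" by auto
  then show ?case using reciprocal_1[OF assms(1)] reciprocal_minus1[OF assms(1)] by auto
next
  case (factor p a)
  have "psi a = kappa a ^ j" using factor by auto
  moreover have "psi p = kappa p ^ j"
    using factor(4)[of "nat p"] factor(1) prime_ge_0_int[of p] by simp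
  moreover have "psi (p * a) = psi p * psi a" using assms(1) by (simp add: reciprocal_def)
  ultimately show ?case by (simp add: kappa_mult power_mult_distrib)
qed simp

lemma reciprocal_prime:
  assumes "reciprocal A psi" "prime c" "c \<noteq> 3" "\<not> int c dvd enorm A" "cubic_symbol c A u"
  shows "psi (int c) = u"
  using assms cubic_symbol_unique by (metis reciprocal_def)

lemma coprime_enormI:
  assumes "\<And>r. prime r \<Longrightarrow> int r dvd a \<Longrightarrow> \<not> int r dvd N"
  shows "coprime a N"
proof (rule ccontr)
  assume "\<not> coprime a N"
  moreover have "gcd a N \<noteq> 0" using assms[of 2] by auto
  ultimately obtain p where "prime p" "p dvd gcd a N"
    using prime_divisorE[of "gcd a N"] by (metis is_unit_gcd)
  then have "prime (nat p)" "int (nat p) dvd a" "int (nat p) dvd N"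
    using prime_ge_0_int[of p] by auto
  then show False using assms by blast
qed

text \<open>Modulo \<open>enorm A\<close>, the identity $(a+b)^2 + 3(a-b)^2 = 4(a^2-ab+b^2)$ expresses 3 through
  $a+b$ and $a-b$; modulo the primes dividing those, $A$ is a rational multiple of $1-\omega$ or of
  $1+\omega=-\omega^2$.\<close>
lemma reciprocal_3:
  assumes "reciprocal A psi" "coprime (ere A) (eim A)" "3 dvd eim A"
  shows "psi 3 = kappa (ere A + eim A) * kappa (ere A - eim A) ^ 2"
proof -
  define a b where ab: "a = ere A" "b = eim A"
  have 3: "\<not> 3 dvd a" "3 dvd b"
    using assms(2,3) coprime_common_divisor[of a b 3] by (auto simp: ab)
  then have sd3: "\<not> 3 dvd a + b" "\<not> 3 dvd a - b" by presburger+
  have c3: "c \<noteq> 3" if "int c dvd e" "\<not> 3 dvd e" for c e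
    using that by (metis of_nat_numeral)
  have nN: "\<not> int c dvd enorm A" if c: "prime c" "int c dvd a + b \<or> int c dvd a - b" for c
  proof
    assume N: "int c dvd enorm A"
    have pr: "prime (int c)" using c by simp
    have cn3: "\<not> int c dvd 3"
      using c c3 sd3 primes_dvd_imp_eq[OF c(1) prime_3_nat] by (metis int_dvd_int_iff of_nat_numeral)
    have "3 * a * b = (a + b) * (a + b) - enorm A" "a * b = enorm A - (a - b) * (a - b)"
      by (simp_all add: ab enorm_def power2_eq_square algebra_simps)
    then have "int c dvd 3 * a * b \<or> int c dvd a * b" using c(2) N by (metis dvd_diff dvd_mult)
    then have "int c dvd a \<or> int c dvd b" using pr cn3 by (auto simp: prime_dvd_mult_iff)
    then have "int c dvd a \<and> int c dvd b"
      using c(2) by (metis dvd_add_left_iff dvd_add_right_iff dvd_diff_commute diff_add_cancel add.commute)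
    then show False
      using assms(2) pr unfolding ab[symmetric] by (meson coprime_common_divisor not_prime_unit)
  qed
  have psi_plus: "psi (a + b) = kappa (a + b) ^ 2"
  proof (rule reciprocal_eqI[OF assms(1)])
    show "a + b \<noteq> 0" using sd3 by auto
    fix r assume r: "prime r" "int r dvd a + b"
    have "A - of_int a * (1 - omega) = of_int (a + b) * omega"
      by (simp add: eis_eq_iff ab)
    moreover have "of_nat r dvd of_int (a + b) * omega"
      using r by (simp add: of_nat_dvd_eis_iff)
    ultimately have "dvdcong (of_nat r) A (of_int a * (1 - omega))"
      by (simp only: dvdcong_def)
    then have "dvdcong (of_nat r) (of_int a * (1 - omega)) A" by (rule dvdcong_sym)
    moreover have "cubic_symbol r (of_int a * (1 - omega)) (1 * kappa (int r) ^ 2)"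
      using r c3 sd3 by (intro cubic_symbol_mult cubic_symbol_of_int cubic_symbol_one_minus_omega) auto
    ultimately have "cubic_symbol r A (kappa (int r) ^ 2)"
      using cubic_symbol_cong by (metis mult_1)
    then show "psi (int r) = kappa (int r) ^ 2"
      using r nN c3 sd3 by (intro reciprocal_prime[OF assms(1)]) auto
  qed
  have psi_minus: "psi (a - b) = kappa (a - b) ^ 2"
  proof (rule reciprocal_eqI[OF assms(1)])
    show "a - b \<noteq> 0" using sd3 by auto
    fix r assume r: "prime r" "int r dvd a - b"
    have "A - of_int (- a) * omega ^ 2 = - of_int (a - b) * omega"
      by (simp add: eis_eq_iff ab omega_sq)
    moreover have "of_nat r dvd - of_int (a - b) * omega"
      using r by (simp add: of_nat_dvd_eis_iff dvd_diff_commute)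
    ultimately have "dvdcong (of_nat r) A (of_int (- a) * omega ^ 2)"
      by (simp only: dvdcong_def)
    then have "dvdcong (of_nat r) (of_int (- a) * omega ^ 2) A" by (rule dvdcong_sym)
    moreover have "cubic_symbol r (of_int (- a) * omega ^ 2) (1 * kappa (int r) ^ 2)"
      using r c3 sd3 by (intro cubic_symbol_mult cubic_symbol_of_int cubic_symbol_power cubic_symbol_omega) auto
    ultimately have "cubic_symbol r A (kappa (int r) ^ 2)"
      using cubic_symbol_cong by (metis mult_1)
    then show "psi (int r) = kappa (int r) ^ 2"
      using r nN c3 sd3 by (intro reciprocal_prime[OF assms(1)]) auto
  qed
  have "(-1) * ((a + b) * (a + b)) - 3 * ((a - b) * (a - b)) = - 4 * enorm A"
    by (simp add: ab enorm_def power2_eq_square algebra_simps)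
  then have "[(-1) * ((a + b) * (a + b)) = 3 * ((a - b) * (a - b))] (mod enorm A)"
    unfolding cong_iff_dvd_diff by (metis dvd_triv_right)
  then have "psi ((-1) * ((a + b) * (a + b))) = psi (3 * ((a - b) * (a - b)))"
    using assms(1) unfolding reciprocal_def by metis
  moreover have mult: "psi (c * e) = psi c * psi e" for c e
    using assms(1) by (simp add: reciprocal_def)
  ultimately have eq: "(kappa (a + b) ^ 2) ^ 2 = psi 3 * (kappa (a - b) ^ 2) ^ 2"
    using psi_plus psi_minus reciprocal_minus1[OF assms(1)]
    by (simp only: mult power2_eq_square mult_1)
  have cube: "kappa (a + b) ^ 3 = 1" "kappa (a - b) ^ 3 = 1"
    using sd3 cube_unit_cube kappa_unit by blast+
  \<comment> \<open>Cubes of \<open>kappa\<close> are inserted to solve the equation between fourth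
    powers for \<open>psi 3\<close>.\<close>
  have "psi 3 = psi 3 * kappa (a - b) ^ 3 * kappa (a - b) ^ 3" by (simp add: cube)
  also have "\<dots> = (psi 3 * (kappa (a - b) ^ 2) ^ 2) * kappa (a - b) ^ 2"
    by (simp add: power2_eq_square power3_eq_cube mult_ac)
  also have "\<dots> = kappa (a + b) ^ 3 * kappa (a + b) * kappa (a - b) ^ 2"
    unfolding eq[symmetric] by (simp add: power2_eq_square power3_eq_cube mult_ac)
  finally show ?thesis using cube unfolding ab by simp
qed

subsection \<open>The symbol of $nx - my\sqrt{-3}$ modulo $p$\<close>

locale pell_form =
  fixes d m n x y :: int and p :: nat
  assumes d: "d > 1" "squarefree d" and pell: "m\<^sup>2 - d * n\<^sup>2 = -4"
    and p: "prime p" "int p = x\<^sup>2 + 3 * d * y\<^sup>2" and y3: "\<not> 3 dvd y" and xy: "[x = y] (mod 3)"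
begin

text \<open>This is nx - my sqrt(-3), with sqrt(-3) written as 1 + 2 omega.\<close>

definition A :: eis where "A = Eis (n * x - m * y) (- 2 * m * y)"

definition g :: int where "g = gcd (ere A) (eim A)"

text \<open>Reciprocity is available for primitive elements; the content \<open>g\<close> is
  rational and does not change the symbol modulo \<open>p\<close>.\<close>

definition A2 :: eis where "A2 = Eis (ere A div g) (eim A div g)"

lemma p_int: "prime (int p)"
  using p(1) by simp

lemma odd_coprime_4: "odd z \<Longrightarrow> coprime z 4" for z :: int
proof -
  assume "odd z"
  then have "coprime z 2" by simp
  moreover have "(4::int) = 2 * 2" by simp
  ultimately show ?thesis by (simp only: coprime_mult_right_iff)
qed

lemma x3: "\<not> 3 dvd x"
  using y3 cong_dvd_iff[OF xy] by simp

lemma sq_mod3: "\<not> 3 dvd (a::int) \<Longrightarrow> a\<^sup>2 mod 3 = 1"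
proof -
  assume "\<not> 3 dvd a"
  then have "a mod 3 = 1 \<or> a mod 3 = 2" by presburger
  then have "(a mod 3)\<^sup>2 mod 3 = 1" by auto
  then show ?thesis by (simp add: power_mod)
qed

text \<open>Otherwise m^2 would be 2 modulo 3.\<close>

lemma n3: "\<not> 3 dvd n"
proof
  assume "3 dvd n"
  then have "3 dvd d * n\<^sup>2" by (simp add: power2_eq_square)
  moreover have "m\<^sup>2 = d * n\<^sup>2 - 4" using pell by simp
  ultimately have "m\<^sup>2 mod 3 = 2" by presburger
  moreover have "m\<^sup>2 mod 3 = 0 \<or> m\<^sup>2 mod 3 = 1" using sq_mod3[of m] by (cases "3 dvd m") auto
  ultimately show False by simp
qed

lemma y_pos: "y\<^sup>2 \<ge> 1" and x_pos: "x\<^sup>2 \<ge> 1"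
proof -
  have "y \<noteq> 0" "x \<noteq> 0" using y3 x3 by auto
  then have "y\<^sup>2 > 0" "x\<^sup>2 > 0" by simp_all
  then show "y\<^sup>2 \<ge> 1" "x\<^sup>2 \<ge> 1" by linarith+
qed

lemma p_gt: "int p > x\<^sup>2" and p_ge: "int p \<ge> 7"
proof -
  have "3 * d * y\<^sup>2 \<ge> 3 * d * 1" using y_pos d(1) by (intro mult_left_mono) auto
  then show "int p > x\<^sup>2" "int p \<ge> 7" using p(2) d(1) x_pos by linarith+
qed

lemma p_odd: "odd p"
  using p(1) p_ge prime_odd_nat by simp

lemma p_not_dvd_x: "\<not> int p dvd x"
proof
  assume "int p dvd x"
  then have "int p dvd x\<^sup>2" by (simp add: power2_eq_square)
  then have "int p \<le> x\<^sup>2" using x_pos by (intro zdvd_imp_le) auto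
  then show False using p_gt by simp
qed

lemma coprime_x_y: "r dvd x \<Longrightarrow> r dvd y \<Longrightarrow> is_unit r" for r :: int
proof -
  assume "r dvd x" "r dvd y"
  then have "r dvd int p" unfolding p(2) power2_eq_square by simp
  then have "is_unit r \<or> int p dvd r"
    using p_int prime_elem_imp_irreducible irreducibleD' by (metis prime_imp_prime_elem)
  then show "is_unit r" using \<open>r dvd x\<close> p_not_dvd_x dvd_trans by blast
qed

lemma p_not_dvd_y: "\<not> int p dvd y"
proof
  assume "int p dvd y"
  then have "int p dvd int p - 3 * d * y\<^sup>2" by (simp add: power2_eq_square)
  then have "int p dvd x\<^sup>2" using p(2) by simp
  then show False using p_not_dvd_x p_int prime_dvd_power by blast
qed

lemma p_not_dvd_small: "\<not> int p dvd 2" "\<not> int p dvd 3"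
  using p_ge by (auto dest: zdvd_imp_le)

lemma p_not_dvd_d: "\<not> int p dvd d"
proof
  assume "int p dvd d"
  then have "int p dvd int p - 3 * d * y\<^sup>2" by simp
  then have "int p dvd x\<^sup>2" using p(2) by simp
  then show False using p_not_dvd_x p_int prime_dvd_power by blast
qed

lemma m_nz: "m \<noteq> 0"
proof
  assume "m = 0"
  then have dn: "d * n\<^sup>2 = 4" using pell by simp
  have "\<bar>n\<bar> < 2"
  proof (rule ccontr)
    assume "\<not> \<bar>n\<bar> < 2"
    then have "2\<^sup>2 \<le> \<bar>n\<bar>\<^sup>2" by (intro power_mono) auto
    then have "2 * 4 \<le> d * n\<^sup>2" using d(1) by (intro mult_mono) auto
    then show False using dn by simp
  qed
  moreover have "n \<noteq> 0" using n3 by auto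
  ultimately have "n = 1 \<or> n = -1" by linarith
  then have "d = 4" using dn by auto
  then have "2\<^sup>2 dvd d" by simp
  then show False using d(2) squarefreeD[of d 2] by auto
qed

lemma A_sel [simp]: "ere A = n * x - m * y" "eim A = - 2 * m * y"
  by (simp_all add: A_def)

lemma g_A2: "g * ere A2 = n * x - m * y" "g * eim A2 = - 2 * m * y"
  by (simp_all add: A2_def g_def)

lemma A_g: "A = of_int g * A2"
  using g_A2 by (simp add: eis_eq_iff)

lemma g_pos: "g > 0"
proof -
  have "eim A \<noteq> 0" using m_nz y_pos by auto
  then show ?thesis unfolding g_def by (metis gcd_eq_0_iff gcd_ge_0_int order_less_le)
qed

lemma coprime_A2: "coprime (ere A2) (eim A2)"
  unfolding A2_def g_def using g_pos unfolding g_def by (simp only: eis.sel) (rule div_gcd_coprime, auto simp del: A_sel)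

lemma g3: "\<not> 3 dvd g"
proof
  assume "3 dvd g"
  then have "3 dvd n * x - m * y" "3 dvd - 2 * m * y" using g_A2 by (metis dvd_mult2)+
  moreover have pr: "prime (3::int)" by simp
  ultimately have "3 dvd m * y" by (simp add: prime_dvd_mult_iff[OF pr])
  then have "3 dvd n * x" using \<open>3 dvd n * x - m * y\<close> by (metis dvd_diff_right_iff dvd_add_right_iff diff_add_cancel dvd_add)
  then show False using n3 x3 by (simp add: prime_dvd_mult_iff[OF pr])
qed

text \<open>Substituting d n^2 = m^2 + 4 and 3 d y^2 = p - x^2 cancels the terms in m^2 x^2.\<close>

lemma enorm_A: "d * (g\<^sup>2 * enorm A2) = int p * m\<^sup>2 + (2 * x)\<^sup>2"
proof -
  have "g\<^sup>2 * enorm A2 = enorm A"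
    by (simp add: A_g enorm_mult)
  also have "enorm A = n\<^sup>2 * x\<^sup>2 + 3 * m\<^sup>2 * y\<^sup>2"
    by (simp add: enorm_def power2_eq_square algebra_simps)
  also have "d * \<dots> = (d * n\<^sup>2) * x\<^sup>2 + (3 * d * y\<^sup>2) * m\<^sup>2"
    by (simp add: algebra_simps)
  also have "d * n\<^sup>2 = m\<^sup>2 + 4" using pell by simp
  also have "3 * d * y\<^sup>2 = int p - x\<^sup>2" using p by simp
  finally show ?thesis by (simp add: algebra_simps power_mult_distrib)
qed

lemma enorm_A2_odd: "odd (enorm A2)"
proof
  assume "even (enorm A2)"
  then have "even (ere A2) \<and> even (eim A2)" by (auto simp: enorm_def)
  then show False using coprime_A2 by (meson coprime_common_divisor odd_one)
qed

text \<open>Primes common to \<open>m\<close> and 2x may divide the norm, where the reciprocity law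
  gives no value of the character. They are divided out, leaving the coprime pair \<open>m1\<close>,
  \<open>x1\<close>.\<close>

definition h :: int where "h = gcd m (2 * x)"
definition m1 :: int where "m1 = m div h"
definition x1 :: int where "x1 = 2 * x div h"

lemma h_pos: "h > 0"
  unfolding h_def using m_nz by (metis gcd_eq_0_iff gcd_ge_0_int order_less_le)

lemma h_m1: "h * m1 = m" and h_x1: "h * x1 = 2 * x"
  by (simp_all add: h_def m1_def x1_def)

lemma coprime_m1_x1: "coprime m1 x1"
  unfolding m1_def x1_def h_def using m_nz by (intro div_gcd_coprime) simp

lemma h3: "\<not> 3 dvd h" and x13: "\<not> 3 dvd x1"
proof -
  have "\<not> 3 dvd 2 * x" using x3 by presburger
  then show "\<not> 3 dvd h" "\<not> 3 dvd x1" using h_x1 by (metis dvd_mult dvd_mult2)+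
qed

text \<open>\<open>h\<close> divides 2x but not always x, so only twice the content is known to be a
  multiple of \<open>h\<close>. The resulting factor 4 can be removed because the norm of
  \<open>A2\<close> is odd.\<close>

lemma enorm_A2_dvd: "enorm A2 dvd int p * m1\<^sup>2 + x1\<^sup>2"
proof -
  have "h dvd m" "h dvd 2 * x" by (simp_all add: h_def)
  then have "h dvd (2 * x) * n - m * (2 * y)" "h dvd m * (- 4 * y)"
    by (meson dvd_diff dvd_mult2)+
  then have "h dvd 2 * ere A" "h dvd 2 * eim A" by (simp_all add: algebra_simps)
  then have "h dvd gcd (2 * ere A) (2 * eim A)" by (rule gcd_greatest)
  also have "gcd (2 * ere A) (2 * eim A) = 2 * g" by (simp only: gcd_mult_left g_def) simp
  finally obtain t where t: "2 * g = h * t" by (elim dvdE)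
  have "h\<^sup>2 * (4 * (int p * m1\<^sup>2 + x1\<^sup>2)) = 4 * (int p * (h * m1)\<^sup>2 + (h * x1)\<^sup>2)"
    by (simp add: power2_eq_square algebra_simps)
  also have "\<dots> = 4 * (int p * m\<^sup>2 + (2 * x)\<^sup>2)"
    by (simp only: h_m1 h_x1)
  also have "\<dots> = d * ((2 * g)\<^sup>2 * enorm A2)"
    unfolding enorm_A[symmetric] by (simp add: power_mult_distrib)
  also have "\<dots> = h\<^sup>2 * (d * t\<^sup>2 * enorm A2)"
    unfolding t by (simp add: power_mult_distrib)
  finally have "4 * (int p * m1\<^sup>2 + x1\<^sup>2) = d * t\<^sup>2 * enorm A2" using h_pos by simp
  then have "enorm A2 dvd 4 * (int p * m1\<^sup>2 + x1\<^sup>2)" by simp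
  moreover have "coprime (enorm A2) 4"
    by (rule odd_coprime_4[OF enorm_A2_odd])
  ultimately show ?thesis using coprime_dvd_mult_right_iff by blast
qed

lemma p_not_dvd_enorm: "\<not> int p dvd enorm A2"
proof
  assume "int p dvd enorm A2"
  then have "int p dvd int p * m\<^sup>2 + (2 * x)\<^sup>2" using enorm_A by (metis dvd_mult)
  then have "int p dvd (2 * x)\<^sup>2" by (simp add: dvd_add_right_iff)
  then show False using p_int p_not_dvd_small p_not_dvd_x by (meson prime_dvd_mult_iff prime_dvd_power)
qed

lemma not_dvd_enorm:
  assumes "prime r" "int r dvd m1 \<or> int r dvd x1"
  shows "\<not> int r dvd enorm A2"
proof
  assume N: "int r dvd enorm A2"
  have pr: "prime (int r)" using assms by simp
  have s: "int r dvd int p * m1\<^sup>2 + x1\<^sup>2" using N enorm_A2_dvd dvd_trans by blast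
  have "r \<noteq> p" using N p_not_dvd_enorm by auto
  then have rp: "\<not> int r dvd int p" using assms(1) p(1) primes_dvd_imp_eq by auto
  from assms(2) have "int r dvd m1 \<and> int r dvd x1"
  proof
    assume m1: "int r dvd m1"
    then have "int r dvd int p * m1\<^sup>2" by (simp add: power2_eq_square)
    then have "int r dvd x1\<^sup>2" using s by (simp add: dvd_add_right_iff)
    then show ?thesis using m1 pr prime_dvd_power by blast
  next
    assume x1: "int r dvd x1"
    then have "int r dvd x1\<^sup>2" by (simp add: power2_eq_square)
    then have "int r dvd int p * m1\<^sup>2" using s by (simp add: dvd_add_left_iff)
    then show ?thesis using x1 pr rp by (meson prime_dvd_mult_iff prime_dvd_power)
  qed
  then show False using coprime_m1_x1 pr by (meson coprime_common_divisor not_prime_unit)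
qed

text \<open>For a + b omega the numbers 2a - b and b are twice the coordinates relative to 1 and
  sqrt(-3); those of \<open>A2\<close> are proportional to nx and -my.\<close>

lemma relation: "(2 * ere A2 - eim A2) * (m * y) = - (eim A2 * (n * x))"
proof -
  have "g * ((2 * ere A2 - eim A2) * (m * y)) = (2 * (g * ere A2) - g * eim A2) * (m * y)"
    by (simp add: algebra_simps)
  also have "\<dots> = - (g * eim A2 * (n * x))" unfolding g_A2 by (simp add: algebra_simps)
  finally have "g * ((2 * ere A2 - eim A2) * (m * y)) = g * (- (eim A2 * (n * x)))" by simp
  then show ?thesis using g_pos by (metis less_irrefl mult_left_cancel)
qed

lemma relation1: "2 * ((2 * ere A2 - eim A2) * (m1 * y)) = - (eim A2 * (n * x1))"
proof -
  have "h * (2 * ((2 * ere A2 - eim A2) * (m1 * y))) = 2 * ((2 * ere A2 - eim A2) * ((h * m1) * y))"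
    by (simp add: algebra_simps)
  also have "\<dots> = - (eim A2 * (n * (2 * x)))" unfolding h_m1 relation by simp
  also have "\<dots> = h * (- (eim A2 * (n * x1)))" unfolding h_x1[symmetric] by simp
  finally show ?thesis using h_pos by (metis less_irrefl mult_left_cancel)
qed

text \<open>Z[sqrt(-3)] has index 2 in Z[omega], so proportionality of coordinates does not settle
  whether \<open>A2\<close> is rational modulo 2. In every parity class an odd omega-coordinate
  would make \<open>p\<close> even or contradict the equation for m and n.\<close>

lemma even_eim_A2:
  assumes "even m1 \<or> even x1"
  shows "even (eim A2)"
proof (rule ccontr)
  assume odd: "odd (eim A2)"
  then have odd': "odd (2 * ere A2 - eim A2)" by simp
  have podd: "odd (x\<^sup>2 + 3 * d * y\<^sup>2)" using p_odd p(2) by (metis even_of_nat)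
  show False
  proof (cases "even n")
    case False
    \<comment> \<open>With n odd, an even m would make 4 divide the squarefree d.\<close>
    have "odd m"
    proof
      assume "even m"
      then obtain e where e: "m = 2 * e" by blast
      have "d * n\<^sup>2 = 4 * (e\<^sup>2 + 1)" using pell e by (simp add: power_mult_distrib)
      then have "2\<^sup>2 dvd d * n\<^sup>2" by simp
      moreover have "coprime (2\<^sup>2) (n\<^sup>2)"
        using odd_coprime_4[of "n\<^sup>2"] False by (simp add: coprime_commute)
      ultimately have "2\<^sup>2 dvd d" by (simp add: coprime_dvd_mult_left_iff)
      then show False using d(2) squarefreeD[of d 2] by auto
    qed
    have "odd d"
    proof
      assume "even d"
      moreover have "m\<^sup>2 = d * n\<^sup>2 - 4" using pell by simp
      ultimately have "even (m\<^sup>2)" by simp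
      then show False using \<open>odd m\<close> by simp
    qed
    have "even ((2 * ere A2 - eim A2) * (m * y)) = even (eim A2 * (n * x))"
      unfolding relation by simp
    then have "even y = even x" using odd odd' False \<open>odd m\<close> by simp
    then show False using podd \<open>odd d\<close> by auto
  next
    case True
    then obtain n' where n': "n = 2 * n'" by blast
    have "m\<^sup>2 = d * n\<^sup>2 - 4" using pell by simp
    then have "even (m\<^sup>2)" using True by simp
    then have "even m" by simp
    then obtain m' where m': "m = 2 * m'" by blast
    have pell': "d * n'\<^sup>2 = m'\<^sup>2 + 1" using pell by (simp add: n' m' power_mult_distrib)
    have "even h" unfolding h_def using \<open>even m\<close> by simp
    have nx: "n * x1 = 2 * (n' * x1)" by (simp only: n' mult.assoc)
    have "eim A2 * (n * x1) = 2 * (eim A2 * (n' * x1))" unfolding nx by (rule mult.left_commute)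
    then have rel: "(2 * ere A2 - eim A2) * (m1 * y) = - (eim A2 * (n' * x1))"
      using relation1 by linarith
    have "even ((2 * ere A2 - eim A2) * (m1 * y)) = even (eim A2 * (n' * x1))"
      unfolding rel by simp
    then have par: "even (m1 * y) = even (n' * x1)" using odd odd' by simp
    have nb: "\<not> (even m1 \<and> even x1)" using coprime_m1_x1 by (meson coprime_common_divisor odd_one)
    show False
    proof (cases "even m1")
      case True
      then have "even n'" using par nb by simp
      from True \<open>even h\<close> have "4 dvd h * m1" by (auto elim!: evenE)
      then have "4 dvd m" by (simp only: h_m1)
      then have "even m'" using m' by presburger
      then have "odd (d * n'\<^sup>2)" unfolding pell' by simp
      then show False using \<open>even n'\<close> by simp
    next
      case False
      then have "even x1" using assms by simp
      then have "even y" using par False by simp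
      from \<open>even x1\<close> \<open>even h\<close> have "4 dvd h * x1" by (auto elim!: evenE)
      then have "4 dvd 2 * x" by (simp only: h_x1)
      then have "even x" by presburger
      then show False using podd \<open>even y\<close> by simp
    qed
  qed
qed

text \<open>Modulo a prime dividing \<open>m1 * x1\<close>, the element \<open>A2\<close> is a rational multiple of 1 or of
  $\sqrt{-3}$.\<close>
lemma cubic_symbol_A2:
  assumes "prime r" "r \<noteq> 3" "int r dvd m1 \<or> int r dvd x1"
  shows "cubic_symbol r A2 1"
proof -
  have pr: "prime (int r)" using assms by simp
  have rational: "cubic_symbol r A2 1" if "int r dvd eim A2"
  proof (rule cubic_symbol_cong)
    show "dvdcong (of_nat r) (of_int (ere A2)) A2"
      using that by (simp add: dvdcong_def of_nat_dvd_eis_iff)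
  qed (rule cubic_symbol_of_int)
  show ?thesis
  proof (cases "r = 2")
    case True
    then show ?thesis using rational even_eim_A2 assms by simp
  next
    case False
    then have r2: "\<not> int r dvd 2"
      using primes_dvd_imp_eq[OF assms(1) two_is_prime_nat] by (metis int_dvd_int_iff of_nat_numeral)
    then have r4: "\<not> int r dvd 4"
      using pr prime_dvd_mult_iff[OF pr, of 2 2] by simp
    have ncop: "\<not> (int r dvd m1 \<and> int r dvd x1)"
      using coprime_m1_x1 pr by (meson coprime_common_divisor not_prime_unit)
    from assms(3) show ?thesis
    proof
      assume m1: "int r dvd m1"
      then have "int r dvd 2 * ((2 * ere A2 - eim A2) * (m1 * y))" by simp
      then have "int r dvd eim A2 * (n * x1)" unfolding relation1 by simp
      moreover have "\<not> int r dvd n"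
      proof
        assume "int r dvd n"
        moreover have "int r dvd m" using m1 h_m1 by (metis dvd_mult)
        ultimately have "int r dvd m\<^sup>2 - d * n\<^sup>2" by (simp add: power2_eq_square)
        then show False using r4 unfolding pell by simp
      qed
      ultimately have "int r dvd eim A2"
        using m1 ncop by (simp add: prime_dvd_mult_iff[OF pr])
      then show ?thesis by (rule rational)
    next
      assume x1: "int r dvd x1"
      then have "int r dvd 2 * ((2 * ere A2 - eim A2) * (m1 * y))" unfolding relation1 by simp
      moreover have "\<not> int r dvd y"
      proof
        assume "int r dvd y"
        have "int r dvd 2 * x" using x1 h_x1 by (metis dvd_mult)
        then have "int r dvd x" using r2 by (simp add: prime_dvd_mult_iff[OF pr])
        then show False using \<open>int r dvd y\<close> coprime_x_y pr not_prime_unit by blast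
      qed
      ultimately have *: "int r dvd 2 * ere A2 - eim A2"
        using x1 ncop r2 by (simp add: prime_dvd_mult_iff[OF pr])
      have "odd r" using assms(1) False prime_odd_nat prime_ge_2_nat by (metis le_neq_implies_less)
      then obtain e where e: "r = 2 * e + 1" by (elim oddE)
      \<comment> \<open>\<open>k\<close> is the inverse of 2 modulo \<open>r\<close>. Since 2a = b
        modulo \<open>r\<close> for A2 = a + b omega, \<open>A2\<close> is kb sqrt(-3)
        there.\<close>
      define k where "k = int e + 1"
      have k: "2 * k = int r + 1" by (simp add: k_def e)
      have "dvdcong (of_nat r) (of_int (k * eim A2) * (1 + 2 * omega)) A2"
      proof -
        have "int r dvd k * (2 * ere A2 - eim A2)" using * by simp
        moreover have "k * eim A2 - ere A2 = int r * ere A2 - k * (2 * ere A2 - eim A2)"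
        proof -
          have "int r * ere A2 - k * (2 * ere A2 - eim A2) = k * eim A2 - ere A2 + (int r + 1 - 2 * k) * ere A2"
            by (simp add: algebra_simps)
          then show ?thesis using k by simp
        qed
        moreover have "2 * (k * eim A2) - eim A2 = int r * eim A2"
          unfolding mult.assoc[symmetric] k by (simp add: algebra_simps)
        ultimately have "int r dvd k * eim A2 - ere A2" "int r dvd 2 * (k * eim A2) - eim A2"
          by (metis dvd_diff dvd_triv_left)+
        then show ?thesis
          unfolding dvdcong_def of_nat_dvd_eis_iff by (simp add: mult_ac)
      qed
      moreover have "cubic_symbol r (of_int (k * eim A2) * (1 + 2 * omega)) (1 * 1)"
        by (intro cubic_symbol_mult cubic_symbol_of_int cubic_symbol_sqrt_minus_3 assms)
      ultimately show ?thesis using cubic_symbol_cong by simp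
    qed
  qed
qed

end

section \<open>Units, quotients of \<open>kappa\<close>, and the Legendre symbol modulo 3\<close>

lemma coprime_cube_unit_mult:
  assumes "cube_unit u" "coprime (ere z) (eim z)"
  shows "coprime (ere (u * z)) (eim (u * z))"
proof (rule coprimeI)
  fix c assume "c dvd ere (u * z)" "c dvd eim (u * z)"
  then have "of_int c dvd u * z" unfolding of_int_dvd_eis_iff by blast
  then have "of_int c dvd u ^ 2 * (u * z)" by (rule dvd_mult)
  also have "u ^ 2 * (u * z) = u ^ 3 * z" by (simp add: power2_eq_square power3_eq_cube mult_ac)
  also have "\<dots> = z" using cube_unit_cube[OF assms(1)] by simp
  finally show "is_unit c" using assms(2) by (auto simp: of_int_dvd_eis_iff dest: coprime_common_divisor)
qed

lemma enorm_cube_unit: "cube_unit u \<Longrightarrow> enorm u = 1"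
  by (auto simp: cube_unit_def omega_sq enorm_def)

lemma mod3_nz_cases: "\<not> 3 dvd (w::int) \<Longrightarrow> w mod 3 = 1 \<or> w mod 3 = 2"
  by presburger

lemma kappa_add9: "kappa (a + 9 * c) = kappa a"
  by (simp add: kappa_def)

text \<open>Modulo 9, z + 3w = z (1 + 3w/z), and \<open>kappa\<close> takes 1 + 3k to omega^(-k).
  Since z^2 = 1 modulo 3, the quotient w/z equals zw there.\<close>

lemma kappa_shift:
  assumes "\<not> 3 dvd z" "\<not> 3 dvd w"
  shows "kappa z * kappa (z + 3 * w) ^ 2 = (if z * w mod 3 = 1 then omega else omega ^ 2)"
proof -
  have "(z + 3 * w) mod 9 = (z mod 9 + (3 * w) mod (3 * 3)) mod 9" by (simp add: mod_add_eq)
  then have s: "(z + 3 * w) mod 9 = (z mod 9 + 3 * (w mod 3)) mod 9" by (simp only: mod_mult_mult1)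
  have "z mod 3 = z mod 9 mod 3" by (rule mod_mod_cancel[symmetric]) simp
  then have t: "z * w mod 3 = (z mod 9 mod 3) * (w mod 3) mod 3" by (metis mod_mult_eq)
  have z: "z mod 9 \<noteq> 0" "z mod 9 \<noteq> 3" "z mod 9 \<noteq> 6" using assms(1) by presburger+
  show ?thesis
    using mod3_nz_cases[OF assms(2)] z
    by (elim disjE; cases z rule: mod9_cases)
      (simp_all add: kappa_def s t omega_products flip: power_mult)
qed

lemma Legendre_3: "Legendre a 3 = (if a mod 3 = 0 then 0 else if a mod 3 = 1 then 1 else -1)"
proof -
  have "QuadRes 3 a \<longleftrightarrow> a mod 3 \<noteq> 2"
  proof
    assume "QuadRes 3 a"
    then obtain y where y: "y\<^sup>2 mod 3 = a mod 3" by (auto simp: QuadRes_def cong_def)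
    have "y\<^sup>2 mod 3 = (y mod 3)\<^sup>2 mod 3" by (simp add: power_mod)
    moreover have "y mod 3 = 0 \<or> y mod 3 = 1 \<or> y mod 3 = 2" by presburger
    ultimately show "a mod 3 \<noteq> 2" using y by auto
  next
    assume "a mod 3 \<noteq> 2"
    then have "a mod 3 = 0 \<or> a mod 3 = 1" by presburger
    then have "[0\<^sup>2 = a] (mod 3) \<or> [1\<^sup>2 = a] (mod 3)" by (auto simp: cong_def)
    then show "QuadRes 3 a" unfolding QuadRes_def by blast
  qed
  moreover have "a mod 3 = 0 \<or> a mod 3 = 1 \<or> a mod 3 = 2" by presburger
  ultimately show ?thesis by (auto simp: Legendre_def cong_def)
qed

text \<open>Stands for omega^t with t a sign; only t = 1 and t = -1 are meant.\<close>

definition omega_sgn :: "int \<Rightarrow> eis" where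
  "omega_sgn t = (if t = 1 then omega else omega ^ 2)"

context pell_form
begin

lemma p3: "p \<noteq> 3"
  using p_ge by auto

text \<open>Multiplication by omega^j serves to make \<open>A2\<close> primary. As p m1^2 = -x1^2
  modulo the norm, psi(p) psi(m1)^2 = psi(x1)^2, which is solved for psi(p) because psi(m1)^3 = 1.
  The power of \<open>kappa (int p)\<close> is the symbol of omega^(2j), which undoes
  omega^j.\<close>

lemma
  assumes psi: "reciprocal (omega ^ j * A2) psi"
  shows psi_prime: "\<And>r. prime r \<Longrightarrow> r \<noteq> 3 \<Longrightarrow> int r dvd m1 \<or> int r dvd x1 \<Longrightarrow> psi (int r) = kappa (int r) ^ j"
    and cubic_symbol_psi: "cubic_symbol p A (kappa (int p) ^ (2 * j) * (psi m1 * psi x1 ^ 2))"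
proof -
  let ?A1 = "omega ^ j * A2"
  have u: "cube_unit (omega ^ j)" by (intro cube_unit_power cube_unit_simps)
  have N: "enorm ?A1 = enorm A2" by (simp add: enorm_mult enorm_cube_unit[OF u])
  show "psi (int r) = kappa (int r) ^ j" if r: "prime r" "r \<noteq> 3" "int r dvd m1 \<or> int r dvd x1" for r
  proof (rule reciprocal_prime[OF psi r(1,2)])
    show "\<not> int r dvd enorm ?A1" unfolding N using not_dvd_enorm r by blast
    show "cubic_symbol r ?A1 (kappa (int r) ^ j)"
      using cubic_symbol_mult[OF cubic_symbol_power[OF cubic_symbol_omega[OF r(1,2)]] cubic_symbol_A2[OF r]]
      by simp
  qed
  have mult: "psi (a * b) = psi a * psi b" for a b using psi by (simp add: reciprocal_def)
  have "[int p * (m1 * m1) = (-1) * (x1 * x1)] (mod enorm ?A1)"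
    using enorm_A2_dvd unfolding N cong_iff_dvd_diff by (simp add: power2_eq_square)
  then have "psi (int p * (m1 * m1)) = psi ((-1) * (x1 * x1))"
    using psi unfolding reciprocal_def by blast
  then have "psi (int p) * (psi m1 * psi m1) = psi x1 * psi x1"
    using reciprocal_minus1[OF psi] by (simp only: mult mult_1)
  moreover have "psi m1 ^ 3 = 1"
  proof -
    have "coprime m1 (enorm ?A1)" unfolding N using not_dvd_enorm by (intro coprime_enormI) blast
    then show ?thesis using psi cube_unit_cube by (simp add: reciprocal_def)
  qed
  ultimately have eq: "psi (int p) = psi m1 * psi x1 ^ 2"
    by (metis mult.assoc mult.commute mult_1 power2_eq_square power3_eq_cube)
  have "cubic_symbol p ?A1 (psi (int p))"
    using psi p(1) p3 p_not_dvd_enorm N by (simp add: reciprocal_def)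
  then have "cubic_symbol p (of_int g * (omega ^ (2 * j) * ?A1)) (1 * (kappa (int p) ^ (2 * j) * psi (int p)))"
    by (intro cubic_symbol_mult cubic_symbol_of_int cubic_symbol_power cubic_symbol_omega p(1) p3)
  moreover have "of_int g * (omega ^ (2 * j) * ?A1) = A"
  proof -
    have "omega ^ (2 * j) * omega ^ j = (omega ^ 3) ^ j"
      unfolding power_mult[symmetric] power_add[symmetric] by (rule arg_cong) simp
    then show ?thesis unfolding A_g by (simp add: mult.assoc[symmetric])
  qed
  ultimately show "cubic_symbol p A (kappa (int p) ^ (2 * j) * (psi m1 * psi x1 ^ 2))"
    by (simp add: eq)
qed

lemma psi_x1:
  assumes "reciprocal (omega ^ j * A2) psi"
  shows "psi x1 = kappa x1 ^ j"
proof (rule reciprocal_eqI[OF assms])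
  show "x1 \<noteq> 0" using x13 by auto
  fix r assume r: "prime r" "int r dvd x1"
  then have "r \<noteq> 3" using x13 by (metis of_nat_numeral)
  then show "psi (int r) = kappa (int r) ^ j"
    using psi_prime[OF assms] r by blast
qed

lemma prime_3_int: "prime (3::int)"
  by simp

text \<open>Here \<open>A2\<close> is primary by itself, and primes other than 3 dividing
  \<open>m1\<close> or \<open>x1\<close> have character value 1, so everything rests on
  \<open>psi 3\<close>.\<close>

lemma cubic_symbol_A_3_dvd:
  assumes "3 dvd m"
  shows "cubic_symbol p A (if 9 dvd m then 1 else omega_sgn (Legendre (m * n div 3) 3))"
    and "\<not> 9 dvd m \<Longrightarrow> Legendre (m * n div 3) 3 \<in> {1, -1}"
proof -
  have "3 dvd g * eim A2" using assms g_A2 by simp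
  then have prim: "3 dvd eim A2" using g3 by (simp add: prime_dvd_mult_iff[OF prime_3_int])
  obtain psi where psi: "reciprocal A2 psi"
    using reciprocal_exists[OF coprime_A2 prim] by blast
  then have psi': "reciprocal (omega ^ 0 * A2) psi" by simp
  have symb: "cubic_symbol p A (psi m1)"
    using cubic_symbol_psi[OF psi'] psi_x1[OF psi'] by simp
  have g3': "kappa g ^ 3 = 1" using g3 kappa_unit cube_unit_cube by blast
  \<comment> \<open>The cube of \<open>kappa g\<close> is 1; inserting it replaces the coordinates
    of \<open>A2\<close> by the explicit ones of \<open>A\<close>.\<close>
  have "psi 3 = kappa g ^ 3 * (kappa (ere A2 + eim A2) * kappa (ere A2 - eim A2) ^ 2)"
    using reciprocal_3[OF psi coprime_A2 prim] g3' by simp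
  also have "\<dots> = kappa (g * (ere A2 + eim A2)) * kappa (g * (ere A2 - eim A2)) ^ 2"
    unfolding kappa_mult by (simp add: power2_eq_square power3_eq_cube mult_ac)
  also have "g * (ere A2 + eim A2) = n * x - 3 * (m * y)"
    using g_A2 by (simp add: distrib_left)
  also have "g * (ere A2 - eim A2) = n * x + m * y"
    using g_A2 by (simp add: right_diff_distrib)
  finally have psi3: "psi 3 = kappa (n * x - 3 * (m * y)) * kappa (n * x + m * y) ^ 2" .
  obtain k where k: "m = 3 * k" using assms by (elim dvdE)
  have nx: "\<not> 3 dvd n * x" using n3 x3 by (simp add: prime_dvd_mult_iff[OF prime_3_int])
  have my: "m * y = 3 * (k * y)" by (simp only: k mult.assoc)
  have "n * x - 3 * (m * y) = n * x + 9 * (- (k * y))" unfolding my by simp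
  then have psi3: "psi 3 = kappa (n * x) * kappa (n * x + 3 * (k * y)) ^ 2"
    using psi3 unfolding my by (simp only: kappa_add9)
  have m1_nz: "m1 \<noteq> 0" using h_m1 m_nz by auto
  have div: "m * n div 3 = k * n" by (simp add: k)
  show "cubic_symbol p A (if 9 dvd m then 1 else omega_sgn (Legendre (m * n div 3) 3))"
  proof (cases "9 dvd m")
    case True
    then have "3 dvd k" using k by presburger
    then obtain l where l: "k = 3 * l" by (elim dvdE)
    have "n * x + 3 * (k * y) = n * x + 9 * (l * y)" by (simp add: l)
    then have "kappa (n * x + 3 * (k * y)) = kappa (n * x)" by (simp only: kappa_add9)
    then have "psi 3 = kappa (n * x) ^ 3" using psi3 by (simp add: power2_eq_square power3_eq_cube mult.assoc)
    then have "psi 3 = 1" using nx kappa_unit cube_unit_cube by metis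
    have "psi m1 = kappa m1 ^ 0"
    proof (rule reciprocal_eqI[OF psi m1_nz])
      fix r assume "prime r" "int r dvd m1"
      then show "psi (int r) = kappa (int r) ^ 0"
        using psi_prime[OF psi'] \<open>psi 3 = 1\<close> by (cases "r = 3") auto
    qed
    then show ?thesis using symb True by simp
  next
    case False
    then have k3: "\<not> 3 dvd k" using k by auto
    have "3 dvd h * m1" using h_m1 assms by simp
    then have "3 dvd m1" using h3 by (simp add: prime_dvd_mult_iff[OF prime_3_int])
    then obtain m2 where m2: "m1 = 3 * m2" by (elim dvdE)
    have "h * m2 = k" using h_m1 m2 k by simp
    then have m23: "\<not> 3 dvd m2" using k3 by (metis dvd_mult)
    have "psi m2 = kappa m2 ^ 0"
    proof (rule reciprocal_eqI[OF psi])
      show "m2 \<noteq> 0" using m23 by auto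
      fix r assume r: "prime r" "int r dvd m2"
      then have "r \<noteq> 3" "int r dvd m1" using m23 m2 by (metis of_nat_numeral, simp)
      then show "psi (int r) = kappa (int r) ^ 0" using psi_prime[OF psi'] r by blast
    qed
    moreover have "psi m1 = psi 3 * psi m2" using psi unfolding reciprocal_def m2 by blast
    ultimately have "psi m1 = psi 3" by simp
    also have "\<dots> = (if n * x * (k * y) mod 3 = 1 then omega else omega ^ 2)"
      unfolding psi3 using k3 y3 by (intro kappa_shift nx) (simp add: prime_dvd_mult_iff[OF prime_3_int])
    \<comment> \<open>As x = y modulo 3 and 3 does not divide x, the product xy is 1 modulo
      3.\<close>
    also have "n * x * (k * y) mod 3 = k * n mod 3"
    proof -
      have "[x * y = x * x] (mod 3)" using xy by (intro cong_mult) (auto intro: cong_sym)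
      also have "[x * x = 1] (mod 3)" using sq_mod3[OF x3] by (simp add: cong_def power2_eq_square)
      finally have "[k * n * (x * y) = k * n * 1] (mod 3)" by (intro cong_mult cong_refl)
      then show ?thesis by (simp add: cong_def mult_ac)
    qed
    finally have "psi m1 = omega_sgn (Legendre (m * n div 3) 3)"
      unfolding div by (simp add: Legendre_3 omega_sgn_def)
    then show ?thesis using symb False by simp
  qed
  show "Legendre (m * n div 3) 3 \<in> {1, -1}" if "\<not> 9 dvd m"
  proof -
    have "\<not> 3 dvd k" using k that by auto
    then have "\<not> 3 dvd k * n" using n3 by (simp add: prime_dvd_mult_iff[OF prime_3_int])
    then show ?thesis unfolding div Legendre_3 by (auto simp: dvd_eq_mod_eq_0)
  qed
qed

text \<open>d = m^2 + 4 = 2 modulo 3 gives p = x^2 + 6 modulo 9, after which the result is the same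
  for every x prime to 3. It is the source of the factor omega when 3 does not divide m, because
  \<open>kappa 7\<close> is omega.\<close>

lemma x_mod9_cube:
  assumes "\<not> 3 dvd m"
  shows "(2 * (int p * x))\<^sup>2 mod 9 = 7"
proof -
  have "d * n\<^sup>2 = m\<^sup>2 + 4" using pell by simp
  then have "(d mod 3) * (n\<^sup>2 mod 3) mod 3 = (m\<^sup>2 mod 3 + 4) mod 3"
    by (metis mod_mult_eq mod_add_left_eq)
  then have "d mod 3 = 2" using sq_mod3[OF n3] sq_mod3[OF assms] by simp
  then have "d * y\<^sup>2 mod 3 = 2" using sq_mod3[OF y3] by (metis mod_mult_eq mod_mod_trivial mult_1_right)
  then obtain e where e: "d * y\<^sup>2 = 3 * e + 2" by (metis mult_div_mod_eq)
  have "int p * x = (x ^ 3 + 6 * x) + 9 * (e * x)"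
    unfolding p(2) mult.assoc e by (simp add: power2_eq_square power3_eq_cube algebra_simps)
  then have "(2 * (int p * x))\<^sup>2 mod 9 = (2 * (x ^ 3 + 6 * x) + 9 * (2 * (e * x)))\<^sup>2 mod 9"
    by (simp add: algebra_simps)
  also have "\<dots> = ((2 * (x ^ 3 + 6 * x) + 9 * (2 * (e * x))) mod 9)\<^sup>2 mod 9"
    by (simp only: power_mod)
  also have "(2 * (x ^ 3 + 6 * x) + 9 * (2 * (e * x))) mod 9 = (2 * (x ^ 3 + 6 * x)) mod 9"
    by (rule mod_mult_self2)
  also have "[2 * (x ^ 3 + 6 * x) = 2 * ((x mod 9) ^ 3 + 6 * (x mod 9))] (mod 9)"
    by (intro cong_mult cong_add cong_pow cong_refl) (simp_all add: cong_def)
  then have "(2 * (x ^ 3 + 6 * x)) mod 9 = 2 * ((x mod 9) ^ 3 + 6 * (x mod 9)) mod 9"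
    by (simp only: cong_def)
  also have "(2 * ((x mod 9) ^ 3 + 6 * (x mod 9)) mod 9)\<^sup>2 mod 9 = 7"
  proof -
    have "x mod 9 \<noteq> 0" "x mod 9 \<noteq> 3" "x mod 9 \<noteq> 6" using x3 by presburger+
    then show ?thesis by (cases x rule: mod9_cases) simp_all
  qed
  finally show ?thesis .
qed

text \<open>The omega-coordinates of omega^2 A and omega A are -(nx - my) and nx + my. As x = y
  modulo 3, the residue of mn decides which one vanishes modulo 3, and this fixes the exponent. All
  character values are then powers of \<open>kappa\<close>, in which the common factor
  \<open>h\<close> enters as a cube.\<close>

lemma cubic_symbol_A_not_3_dvd:
  assumes "\<not> 3 dvd m"
  shows "cubic_symbol p A ((omega * kappa m) ^ (if m * n mod 3 = 1 then 2 else 1))"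
proof -
  define j where "j = (if m * n mod 3 = 1 then 2 else 1 :: nat)"
  have prim: "3 dvd eim (omega ^ j * A2)"
  proof -
    have "3 dvd g * eim (omega ^ j * A2)"
    proof (cases "m * n mod 3 = 1")
      case True
      have "(m mod 3) * (n mod 3) mod 3 = 1" using True by (simp add: mod_mult_eq)
      then have "n mod 3 = m mod 3"
        using mod3_nz_cases[OF assms] mod3_nz_cases[OF n3] by auto
      then have "[n * x = m * y] (mod 3)" using xy by (intro cong_mult) (auto simp: cong_def)
      then have "3 dvd g * ere A2" unfolding g_A2 by (simp add: cong_iff_dvd_diff)
      then show ?thesis using True by (simp add: j_def omega_sq del: A_sel)
    next
      case False
      have "\<not> 3 dvd m * n" using assms n3 by (simp add: prime_dvd_mult_iff[OF prime_3_int])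
      then have "m * n mod 3 = 2" using False by presburger
      then have "(m mod 3) * (n mod 3) mod 3 = 2" by (simp add: mod_mult_eq)
      then have "n mod 3 = (- m) mod 3"
        using mod3_nz_cases[OF assms] mod3_nz_cases[OF n3] by (auto simp: zmod_zminus1_eq_if)
      then have "[n * x = - m * y] (mod 3)" using xy by (intro cong_mult) (auto simp: cong_def)
      then have "3 dvd g * ere A2 - g * eim A2" unfolding g_A2 by (simp add: cong_iff_dvd_diff add.commute)
      then show ?thesis using False by (simp add: j_def right_diff_distrib)
    qed
    then show ?thesis using g3 prime_dvd_mult_iff[OF prime_3_int] by blast
  qed
  have "coprime (ere (omega ^ j * A2)) (eim (omega ^ j * A2))"
    by (intro coprime_cube_unit_mult cube_unit_power cube_unit_simps coprime_A2)
  then obtain psi where psi: "reciprocal (omega ^ j * A2) psi"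
    using reciprocal_exists prim by blast
  have "psi m1 = kappa m1 ^ j"
  proof (rule reciprocal_eqI[OF psi])
    show "m1 \<noteq> 0" using h_m1 m_nz by auto
    fix r assume r: "prime r" "int r dvd m1"
    have "\<not> 3 dvd m1" using h_m1 assms by (metis dvd_mult)
    then have "r \<noteq> 3" using r(2) by (metis of_nat_numeral)
    then show "psi (int r) = kappa (int r) ^ j"
      using psi_prime[OF psi] r by blast
  qed
  then have "cubic_symbol p A (kappa (int p) ^ (2 * j) * (kappa m1 ^ j * (kappa x1 ^ j) ^ 2))"
    using cubic_symbol_psi[OF psi] psi_x1[OF psi] by simp
  also have "kappa (int p) ^ (2 * j) * (kappa m1 ^ j * (kappa x1 ^ j) ^ 2) =
      (kappa (int p) ^ 2 * (kappa m1 * kappa x1 ^ 2)) ^ j"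
    by (simp add: power_mult_distrib power_mult[symmetric] mult.commute)
  also have "kappa m1 * kappa x1 ^ 2 = kappa m * kappa (2 * x) ^ 2"
  proof -
    have "kappa m * kappa (2 * x) ^ 2 = kappa (h * m1) * kappa (h * x1) ^ 2"
      by (simp only: h_m1 h_x1)
    also have "\<dots> = kappa h ^ 3 * (kappa m1 * kappa x1 ^ 2)"
      unfolding kappa_mult by (simp add: power2_eq_square power3_eq_cube mult_ac)
    finally show ?thesis using cube_unit_cube[OF kappa_unit[OF h3]] by simp
  qed
  also have "kappa (int p) ^ 2 * (kappa m * kappa (2 * x) ^ 2) = kappa ((2 * (int p * x))\<^sup>2) * kappa m"
    unfolding power2_eq_square kappa_mult by (simp only: mult_ac)
  also have "kappa ((2 * (int p * x))\<^sup>2) = omega"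
    unfolding kappa_def x_mod9_cube[OF assms] by simp
  finally show ?thesis by (simp only: j_def)
qed

text \<open>The classes 4 and 5 join 0 because omega times \<open>kappa m\<close> is 1 there. The
  last two items ensure that \<open>omega_sgn\<close> is only read at a sign.\<close>

lemma cubic_symbol_value:
  obtains u where "cubic_symbol p A u"
    and "m mod 9 \<in> {0, 4, 5} \<Longrightarrow> u = 1"
    and "m mod 9 \<in> {3, 6} \<Longrightarrow> u = omega_sgn (Legendre (m * n div 3) 3)"
    and "m mod 9 \<in> {1, 8} \<Longrightarrow> u = omega_sgn (- Legendre (m * n) 3)"
    and "m mod 9 \<in> {2, 7} \<Longrightarrow> u = omega_sgn (Legendre (m * n) 3)"
    and "m mod 9 \<in> {3, 6} \<Longrightarrow> Legendre (m * n div 3) 3 \<in> {1, -1}"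
    and "m mod 9 \<in> {1, 2, 7, 8} \<Longrightarrow> Legendre (m * n) 3 \<in> {1, -1}"
proof (cases "3 dvd m")
  case True
  have "m mod 9 \<in> {0, 3, 6}" using True by (cases m rule: mod9_cases) (auto, presburger+)
  moreover have "9 dvd m \<longleftrightarrow> m mod 9 = 0" by presburger
  ultimately show thesis
    using that cubic_symbol_A_3_dvd[OF True] by (cases "9 dvd m") auto
next
  case False
  then have mod: "m mod 9 \<noteq> 0" "m mod 9 \<noteq> 3" "m mod 9 \<noteq> 6" by presburger+
  have "\<not> 3 dvd m * n" using False n3 by (simp add: prime_dvd_mult_iff[OF prime_3_int])
  then have mn: "m * n mod 3 \<noteq> 0" by (simp add: dvd_eq_mod_eq_0)
  show thesis
  proof (rule that[OF cubic_symbol_A_not_3_dvd[OF False]])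
    show "Legendre (m * n) 3 \<in> {1, -1}" using mn by (auto simp: Legendre_3)
  qed (use mod mn in \<open>auto simp: kappa_def Legendre_3 omega_sgn_def omega_products power_mult_distrib
        simp flip: power_Suc power_mult\<close>)
qed

end

section \<open>Passage from Eisenstein integers to integers modulo p\<close>

text \<open>Substitution of \<open>w\<close> for omega, multiplicative modulo divisors of w^2 + w +
  1.\<close>

definition eis_eval :: "int \<Rightarrow> eis \<Rightarrow> int" where
  "eis_eval w z = ere z + eim z * w"

lemma eis_eval_mult:
  assumes "M dvd w\<^sup>2 + w + 1"
  shows "[eis_eval w (a * b) = eis_eval w a * eis_eval w b] (mod M)"
proof -
  have "eis_eval w (a * b) - eis_eval w a * eis_eval w b = - (eim a * eim b) * (w\<^sup>2 + w + 1)"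
    by (simp add: eis_eval_def power2_eq_square algebra_simps)
  then show ?thesis using assms by (simp add: cong_iff_dvd_diff)
qed

lemma eis_eval_power:
  assumes "M dvd w\<^sup>2 + w + 1"
  shows "[eis_eval w (a ^ k) = eis_eval w a ^ k] (mod M)"
proof (induction k)
  case (Suc k)
  have "[eis_eval w (a * a ^ k) = eis_eval w a * eis_eval w (a ^ k)] (mod M)"
    by (rule eis_eval_mult[OF assms])
  also have "[eis_eval w a * eis_eval w (a ^ k) = eis_eval w a * eis_eval w a ^ k] (mod M)"
    by (intro cong_mult cong_refl Suc)
  finally show ?case by simp
qed (simp add: eis_eval_def)

lemma eis_eval_dvdcong:
  assumes "dvdcong (of_nat c) a b"
  shows "[eis_eval w a = eis_eval w b] (mod int c)"
proof -
  have "int c dvd ere (a - b) + eim (a - b) * w"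
    using assms unfolding dvdcong_def of_nat_dvd_eis_iff by (meson dvd_add dvd_mult2)
  then show ?thesis by (simp add: cong_iff_dvd_diff eis_eval_def algebra_simps)
qed

context pell_form
begin

lemma p_mod3: "p mod 3 = 1"
proof -
  have "int p mod 3 = x\<^sup>2 mod 3" unfolding p(2) by (simp add: mult.assoc)
  then have "int p mod 3 = 1" using sq_mod3[OF x3] by simp
  then show ?thesis by presburger
qed

text \<open>Sending $\sqrt{-3}$ to $T = xs/(dy)$ defines a homomorphism from $\mathbb{Z}[\omega]$ to the
  integers modulo $p$; it maps \<open>A\<close> and its conjugate to $yT(ns \mp m)$.\<close>
lemma power_eq_eis_eval:
  fixes s i2 i T w :: int
  assumes s: "[s\<^sup>2 = d] (mod int p)" and i2: "[2 * i2 = 1] (mod int p)"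
    and i: "[d * y * i = 1] (mod int p)" and u: "cubic_symbol p A u"
  defines "T \<equiv> x * i * s" and "w \<equiv> i2 * (- 1 + T)"
  shows "[((m + n * s) * i2) ^ (p div 3) = eis_eval w u] (mod int p)"
    and "[eis_eval w omega = i2 * (- 1 + T)] (mod int p)"
    and "[eis_eval w (omega ^ 2) = i2 * (- 1 - T)] (mod int p)"
proof -
  define k where "k = p div 3"
  have k: "p - 1 = 3 * k" "k > 0" using p_mod3 p_ge unfolding k_def by presburger+
  have nd_mult: "\<not> int p dvd a * b" if "\<not> int p dvd a" "\<not> int p dvd b" for a b
    using that p_int by (simp add: prime_dvd_mult_iff)
  have x2: "[x\<^sup>2 = - 3 * d * y\<^sup>2] (mod int p)"
    by (simp add: cong_iff_dvd_diff p(2))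
  have T2: "[T\<^sup>2 = - 3] (mod int p)"
  proof -
    have "T\<^sup>2 = x\<^sup>2 * i\<^sup>2 * s\<^sup>2" by (simp add: T_def power_mult_distrib)
    also have "[\<dots> = (- 3 * d * y\<^sup>2) * i\<^sup>2 * d] (mod int p)"
      by (intro cong_mult x2 s cong_refl)
    also have "(- 3 * d * y\<^sup>2) * i\<^sup>2 * d = - 3 * (d * y * i)\<^sup>2"
      by (simp add: power2_eq_square)
    also have "[\<dots> = - 3 * 1\<^sup>2] (mod int p)" by (intro cong_mult cong_pow i cong_refl)
    finally show ?thesis by simp
  qed
  have w1: "[1 + 2 * w = T] (mod int p)"
  proof -
    have "1 + 2 * w = 1 + (2 * i2) * (- 1 + T)" by (simp add: w_def)
    also have "[\<dots> = 1 + 1 * (- 1 + T)] (mod int p)" by (intro cong_add cong_mult i2 cong_refl)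
    finally show ?thesis by simp
  qed
  have w: "int p dvd w\<^sup>2 + w + 1"
  proof -
    have "[(1 + 2 * w)\<^sup>2 + 3 = T\<^sup>2 + 3] (mod int p)" by (intro cong_add cong_pow w1 cong_refl)
    also have "[T\<^sup>2 + 3 = - 3 + 3] (mod int p)" by (intro cong_add T2 cong_refl)
    also have "(1 + 2 * w)\<^sup>2 + 3 = 2 * (2 * (w\<^sup>2 + w + 1))" by (simp add: power2_eq_square algebra_simps)
    finally have "int p dvd 2 * (2 * (w\<^sup>2 + w + 1))" by (simp add: cong_0_iff)
    then show ?thesis using p_int p_not_dvd_small(1) by (metis prime_dvd_mult_iff)
  qed
  have xs: "[y * T * s = x] (mod int p)"
  proof -
    have "y * T * s = x * i * y * s\<^sup>2" by (simp add: T_def power2_eq_square)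
    also have "[\<dots> = x * i * y * d] (mod int p)" by (intro cong_mult s cong_refl)
    also have "x * i * y * d = x * (d * y * i)" by simp
    also have "[\<dots> = x * 1] (mod int p)" by (intro cong_mult i cong_refl)
    finally show ?thesis by simp
  qed
  have evA: "[eis_eval w A = y * T * (n * s - m)] (mod int p)"
  proof -
    have "eis_eval w A = n * x - m * y * (1 + 2 * w)" by (simp add: eis_eval_def algebra_simps)
    also have "[\<dots> = n * (y * T * s) - m * y * T] (mod int p)"
      by (intro cong_diff cong_mult cong_refl w1 cong_sym[OF xs])
    finally show ?thesis by (simp add: algebra_simps)
  qed
  have evcA: "[eis_eval w (cnj_eis A) = y * T * (m + n * s)] (mod int p)"
  proof -
    have "eis_eval w (cnj_eis A) = n * x + m * y * (1 + 2 * w)" by (simp add: eis_eval_def algebra_simps)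
    also have "[\<dots> = n * (y * T * s) + m * y * T] (mod int p)"
      by (intro cong_add cong_mult cong_refl w1 cong_sym[OF xs])
    finally show ?thesis by (simp add: algebra_simps)
  qed
  define U where "U = eis_eval w u"
  have main: "[U * (m + n * s) ^ k = (n * s - m) ^ k] (mod int p)"
  proof -
    have "dvdcong (of_nat p) (u * cnj_eis A ^ k) (A ^ k)"
      using u p_mod3 by (simp add: cubic_symbol_def k_def)
    then have ev: "[eis_eval w (u * cnj_eis A ^ k) = eis_eval w (A ^ k)] (mod int p)"
      by (rule eis_eval_dvdcong)
    have "[(y * T) ^ k * (U * (m + n * s) ^ k) = U * (y * T * (m + n * s)) ^ k] (mod int p)"
      by (simp add: power_mult_distrib mult_ac)
    also have "[U * (y * T * (m + n * s)) ^ k = U * eis_eval w (cnj_eis A) ^ k] (mod int p)"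
      by (intro cong_mult cong_pow cong_refl cong_sym[OF evcA])
    also have "[U * eis_eval w (cnj_eis A) ^ k = U * eis_eval w (cnj_eis A ^ k)] (mod int p)"
      by (intro cong_mult cong_refl cong_sym[OF eis_eval_power[OF w]])
    also have "[U * eis_eval w (cnj_eis A ^ k) = eis_eval w (u * cnj_eis A ^ k)] (mod int p)"
      unfolding U_def by (intro cong_sym[OF eis_eval_mult[OF w]])
    also note ev
    also have "[eis_eval w (A ^ k) = eis_eval w A ^ k] (mod int p)" by (rule eis_eval_power[OF w])
    also have "[eis_eval w A ^ k = (y * T * (n * s - m)) ^ k] (mod int p)" by (intro cong_pow evA)
    also have "(y * T * (n * s - m)) ^ k = (y * T) ^ k * (n * s - m) ^ k" by (rule power_mult_distrib)
    finally have "[(y * T) ^ k * (U * (m + n * s) ^ k) = (y * T) ^ k * (n * s - m) ^ k] (mod int p)" .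
    moreover have "coprime ((y * T) ^ k) (int p)"
    proof -
      have "\<not> int p dvd T"
      proof
        assume "int p dvd T"
        then have "int p dvd T\<^sup>2" by (simp add: power2_eq_square)
        then have "int p dvd - 3" using cong_dvd_iff[OF T2] by simp
        then show False using p_not_dvd_small by simp
      qed
      then have "\<not> int p dvd y * T" using p_not_dvd_y nd_mult by blast
      then have "coprime (int p) (y * T)" using p_int prime_imp_coprime by blast
      then show ?thesis by (simp add: coprime_commute)
    qed
    ultimately show ?thesis by (simp add: cong_mult_lcancel)
  qed
  define E where "E = ((m + n * s) * i2) ^ k"
  \<comment> \<open>(ns + m)(ns - m) = d n^2 - m^2 = 4 modulo p, so the quotient in
    \<open>main\<close> is the inverse square of (m + ns)/2, raised to the power k.\<close>
  have UE: "[U * E\<^sup>2 = 1] (mod int p)"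
  proof -
    have "U * E\<^sup>2 = (U * (m + n * s) ^ k) * ((m + n * s) ^ k * (i2\<^sup>2) ^ k)"
      by (simp add: E_def power_mult_distrib power2_eq_square mult_ac)
    also have "[\<dots> = (n * s - m) ^ k * ((m + n * s) ^ k * (i2\<^sup>2) ^ k)] (mod int p)"
      by (intro cong_mult main cong_refl)
    also have "(n * s - m) ^ k * ((m + n * s) ^ k * (i2\<^sup>2) ^ k) = ((n\<^sup>2 * s\<^sup>2 - m\<^sup>2) * i2\<^sup>2) ^ k"
      unfolding power_mult_distrib[symmetric] by (rule arg_cong[of _ _ "\<lambda>z. z ^ k"])
        (simp add: power2_eq_square algebra_simps)
    also have "[\<dots> = ((n\<^sup>2 * d - m\<^sup>2) * i2\<^sup>2) ^ k] (mod int p)"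
      by (intro cong_pow cong_mult cong_diff s cong_refl)
    also have "n\<^sup>2 * d - m\<^sup>2 = 4" using pell by (simp add: mult.commute)
    also have "(4 * i2\<^sup>2) ^ k = ((2 * i2)\<^sup>2) ^ k" by (simp add: power_mult_distrib)
    also have "[\<dots> = (1\<^sup>2) ^ k] (mod int p)" by (intro cong_pow i2)
    finally show ?thesis by simp
  qed
  \<comment> \<open>Fermat's theorem with exponent 3k = p - 1; it turns U = E^(-2) into U =
    E.\<close>
  have E3: "[E ^ 3 = 1] (mod int p)"
  proof -
    have "\<not> int p dvd (m + n * s) * i2"
    proof
      assume "int p dvd (m + n * s) * i2"
      then have "int p dvd E" unfolding E_def using k(2) by (simp add: dvd_power_le dvd_trans)
      then have "int p dvd U * E\<^sup>2" by (simp add: power2_eq_square)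
      then have "int p dvd 1" using cong_dvd_iff[OF UE] by simp
      then show False using p_int not_prime_unit by blast
    qed
    then have "[((m + n * s) * i2) ^ (p - 1) = 1] (mod int p)" by (rule fermat_theorem_int[OF p(1)])
    then show ?thesis unfolding E_def k(1) by (simp add: power_mult[symmetric] mult.commute)
  qed
  have "[E * 1 = E * (U * E\<^sup>2)] (mod int p)" by (intro cong_mult cong_refl cong_sym[OF UE])
  also have "E * (U * E\<^sup>2) = U * E ^ 3" by (simp add: power2_eq_square power3_eq_cube)
  also have "[U * E ^ 3 = U * 1] (mod int p)" by (intro cong_mult cong_refl E3)
  finally show "[((m + n * s) * i2) ^ (p div 3) = eis_eval w u] (mod int p)"
    by (simp add: E_def U_def k_def)
  show "[eis_eval w omega = i2 * (- 1 + T)] (mod int p)"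
    by (simp add: eis_eval_def w_def)
  have "i2 * (- 1 - T) - eis_eval w (omega ^ 2) = 1 - 2 * i2"
    by (simp add: eis_eval_def omega_sq w_def algebra_simps)
  moreover have "int p dvd 1 - 2 * i2" using cong_sym[OF i2] by (simp add: cong_iff_dvd_diff)
  ultimately have "[i2 * (- 1 - T) = eis_eval w (omega ^ 2)] (mod int p)"
    by (simp only: cong_iff_dvd_diff)
  then show "[eis_eval w (omega ^ 2) = i2 * (- 1 - T)] (mod int p)"
    by (rule cong_sym)
qed

end

section \<open>The four classes of m modulo 9\<close>

theorem theorem8p1:
  fixes d m n p x y s :: int
  assumes "d > 1" and "squarefree d"
    and "m\<^sup>2 - d * n\<^sup>2 = -4"
    and "prime p" and "p = x\<^sup>2 + 3 * d * y\<^sup>2"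
    and "\<not> 3 dvd y" and "[x = y] (mod 3)"
    and "[s\<^sup>2 = d] (mod p)"
  shows
    "([m = 0] (mod 9) \<or> [m = 4] (mod 9) \<or> [m = -4] (mod 9) \<longrightarrow>
        [((m + n * s) * modular_inverse p 2) ^ nat ((p - 1) div 3) = 1] (mod p)) \<and>
     ([m = 3] (mod 9) \<or> [m = -3] (mod 9) \<longrightarrow>
        [((m + n * s) * modular_inverse p 2) ^ nat ((p - 1) div 3) =
          modular_inverse p 2 *
            (-1 + Legendre (m * n div 3) 3 * (x * modular_inverse p (d * y)) * s)] (mod p)) \<and>
     ([m = 1] (mod 9) \<or> [m = -1] (mod 9) \<longrightarrow>
        [((m + n * s) * modular_inverse p 2) ^ nat ((p - 1) div 3) =
          modular_inverse p 2 *
            (-1 - Legendre (m * n) 3 * (x * modular_inverse p (d * y)) * s)] (mod p)) \<and>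
     ([m = 2] (mod 9) \<or> [m = -2] (mod 9) \<longrightarrow>
        [((m + n * s) * modular_inverse p 2) ^ nat ((p - 1) div 3) =
          modular_inverse p 2 *
            (-1 + Legendre (m * n) 3 * (x * modular_inverse p (d * y)) * s)] (mod p))"
proof -
  define P where "P = nat p"
  have P: "p = int P" "prime P" using assms(4) prime_ge_0_int[of p] by (simp_all add: P_def)
  interpret pell_form d m n x y P
    using assms P by unfold_locales auto
  define i2 i where "i2 = modular_inverse p 2" and "i = modular_inverse p (d * y)"
  define T where "T = x * i * s"
  have inv: "[a * modular_inverse p a = 1] (mod p)" if "\<not> p dvd a" for a
    using that prime_imp_coprime[OF assms(4)] by (intro cong_modular_inverse1) (simp add: coprime_commute)
  have i2: "[2 * i2 = 1] (mod int P)"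
    using inv[of 2] p_not_dvd_small by (simp add: P(1) i2_def)
  have "\<not> p dvd d * y" using p_not_dvd_d p_not_dvd_y assms(4) by (simp add: P(1) prime_dvd_mult_iff)
  then have i: "[d * y * i = 1] (mod int P)"
    using inv by (simp add: P(1) i_def)
  have s: "[s\<^sup>2 = d] (mod int P)" using assms P by simp
  obtain u where u: "cubic_symbol P A u"
    "m mod 9 \<in> {0, 4, 5} \<Longrightarrow> u = 1"
    "m mod 9 \<in> {3, 6} \<Longrightarrow> u = omega_sgn (Legendre (m * n div 3) 3)"
    "m mod 9 \<in> {1, 8} \<Longrightarrow> u = omega_sgn (- Legendre (m * n) 3)"
    "m mod 9 \<in> {2, 7} \<Longrightarrow> u = omega_sgn (Legendre (m * n) 3)"
    "m mod 9 \<in> {3, 6} \<Longrightarrow> Legendre (m * n div 3) 3 \<in> {1, -1}"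
    "m mod 9 \<in> {1, 2, 7, 8} \<Longrightarrow> Legendre (m * n) 3 \<in> {1, -1}"
    using cubic_symbol_value by blast
  have exp: "nat ((p - 1) div 3) = P div 3"
  proof -
    have "P = 3 * (P div 3) + 1" using p_mod3 by presburger
    then have "p - 1 = 3 * int (P div 3)" unfolding P(1) by linarith
    then show ?thesis by simp
  qed
  note ev = power_eq_eis_eval[OF s i2 i u(1), folded T_def, folded P(1)]
  \<comment> \<open>t = 1 selects the image (-1 + T)/2 of omega and t = -1 the image (-1 - T)/2 of
    omega^2, so the exponent of omega becomes the sign of T.\<close>
  have sgn: "[((m + n * s) * i2) ^ (P div 3) = i2 * (- 1 + t * (x * i) * s)] (mod p)"
    if "u = omega_sgn t" "t \<in> {1, -1}" for t
  proof (cases "t = 1")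
    case True
    then show ?thesis using cong_trans[OF ev(1)] ev(2) that(1) by (simp add: omega_sgn_def T_def)
  next
    case False
    then have "t = - 1" using that(2) by simp
    then show ?thesis using cong_trans[OF ev(1)] ev(3) that(1) by (simp add: omega_sgn_def T_def)
  qed
  have m9: "m mod 9 = r mod 9" if "[m = r] (mod 9)" for r
    using that by (simp add: cong_def)
  show ?thesis
    unfolding exp i2_def[symmetric] i_def[symmetric]
  proof (intro conjI impI)
    assume "[m = 0] (mod 9) \<or> [m = 4] (mod 9) \<or> [m = - 4] (mod 9)"
    then have "m mod 9 \<in> {0, 4, 5}" by (auto dest: m9)
    then have "u = 1" by (rule u(2))
    then show "[((m + n * s) * i2) ^ (P div 3) = 1] (mod p)"
      using ev(1) by (simp add: eis_eval_def)
  next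
    assume "[m = 3] (mod 9) \<or> [m = - 3] (mod 9)"
    then have "m mod 9 \<in> {3, 6}" by (auto dest: m9)
    then show "[((m + n * s) * i2) ^ (P div 3) = i2 * (- 1 + Legendre (m * n div 3) 3 * (x * i) * s)] (mod p)"
      using u(3,6) by (intro sgn)
  next
    assume "[m = 1] (mod 9) \<or> [m = - 1] (mod 9)"
    then have r: "m mod 9 \<in> {1, 8}" by (auto dest: m9)
    then have "- Legendre (m * n) 3 \<in> {1, -1}" using u(7) by auto
    then show "[((m + n * s) * i2) ^ (P div 3) = i2 * (- 1 - Legendre (m * n) 3 * (x * i) * s)] (mod p)"
      using sgn[OF u(4)[OF r]] by simp
  next
    assume "[m = 2] (mod 9) \<or> [m = - 2] (mod 9)"
    then have r: "m mod 9 \<in> {2, 7}" by (auto dest: m9)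
    then have "Legendre (m * n) 3 \<in> {1, -1}" using u(7) by auto
    then show "[((m + n * s) * i2) ^ (P div 3) = i2 * (- 1 + Legendre (m * n) 3 * (x * i) * s)] (mod p)"
      using sgn[OF u(5)[OF r]] by simp
  qed
qed

end
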